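(* Let $\{T_i\}_{i=1}^M$ be a generalized quantum $N$-instrument on $\mathcal H_0,\dots,\mathcal H_{2N-1}$. Then $\{T_i\}_{i=1}^M$ is an extremal point of the convex set of generalized quantum $N$-instruments on $\mathcal H_0,\dots,\mathcal H_{2N-1}$ with $M$ outcomes if and only if the family of operators $\mathbb D_M\cup\mathbb D_{(N)}$ is linearly independent over $\mathbb R$.
   Context: All Hilbert spaces are finite-dimensional, $d_k=\dim\mathcal H_k$, and $I_k$ is the identity on $\mathcal H_k$. A deterministic quantum $N$-comb on $\mathcal H_0,\dots,\mathcal H_{2N-1}$ is a positive operator $R$ on $\mathcal H_0\otimes\cdots\otimes\mathcal H_{2N-1}$ for which there are operators $R^{(n)}$ on $\mathcal H_0\otimes\cdots\otimes\mathcal H_{2n-1}$, $n=1,\dots,N$, with $R^{(N)}=R$, $\operatorname{Tr}_{2n-1}R^{(n)}=I_{2n-2}\otimes R^{(n-1)}$ for $2\le n\le N$, and $\operatorname{Tr}_1R^{(1)}=I_0$ (partial traces over the indicated factor). A generalized quantum $N$-instrument with $M$ outcomes is a family $\{T_i\}_{i=1}^M$ of positive operators on $\mathcal H_0\otimes\cdots\otimes\mathcal H_{2N-1}$ whose sum $\sum_iT_i$ is a deterministic quantum $N$-comb; such families form a convex set. Let $\mathcal V_i=\operatorname{Supp}(T_i)$ and let $\mathbb H_i$ be a basis of the real vector space of hermitian operators $X$ with $\operatorname{Supp}(X)\subseteq\mathcal V_i$ (e.g. the hermitian combinations of $|v^i_n\rangle\langle v^i_m|$, with $\{|v^i_n\rangle\}$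 an orthonormal eigenbasis of $T_i$ on $\mathcal V_i$); $\mathbb D_M$ is the family $\bigcup_{i=1}^M\mathbb H_i$. For each $k$ let $\{E^{(k)}_a\}_{a=2}^{d_k^2}$ be a basis of the traceless hermitian operators on $\mathcal H_k$, and for each even $k$ let $\{F^{(k)}_j\}_{j=1}^{d_k^2\cdots d_0^2}$ be a basis of hermitian operators on $\mathcal H_k\otimes\cdots\otimes\mathcal H_0$. Then $\mathbb D_{(N)}$ is the set of operators $I_{2N-1}\otimes\cdots\otimes I_{2n}\otimes E^{(2n-1)}_a\otimes F^{(2n-2)}_j$ for $n=1,\dots,N$ and all $a,j$ (no identity factors when $n=N$). *)

theory Defs
  imports Complex_Main "Jordan_Normal_Form.Matrix"
begin

text \<open>Conventions. An operator on H_0 (x) ... (x) H_(m-1) is a complex square matrix of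
dimension dimp d m = d 0 * ... * d (m-1). Multi-indices are encoded in mixed radix with
factor H_(m-1) most significant, i.e. the ordering H_(m-1) (x) ... (x) H_0 used in the paper;
the Kronecker product kron A B puts A in the more significant position.\<close>

definition dimp :: "(nat \<Rightarrow> nat) \<Rightarrow> nat \<Rightarrow> nat" where
  "dimp d m = (\<Prod>k<m. d k)"

definition kron :: "complex mat \<Rightarrow> complex mat \<Rightarrow> complex mat" where
  "kron A B = mat (dim_row A * dim_row B) (dim_col A * dim_col B)
     (\<lambda>(i,j). A $$ (i div dim_row B, j div dim_col B) * B $$ (i mod dim_row B, j mod dim_col B))"

definition ptrace_top :: "nat \<Rightarrow> nat \<Rightarrow> complex mat \<Rightarrow> complex mat" where
  "ptrace_top a b X = mat b b (\<lambda>(i,j). \<Sum>k<a. X $$ (k*b+i, k*b+j))"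

definition mtrace :: "complex mat \<Rightarrow> complex" where
  "mtrace X = (\<Sum>i<dim_row X. X $$ (i,i))"

definition hermitian_op :: "nat \<Rightarrow> complex mat \<Rightarrow> bool" where
  "hermitian_op n X \<longleftrightarrow> X \<in> carrier_mat n n \<and> (\<forall>i<n. \<forall>j<n. X $$ (j,i) = cnj (X $$ (i,j)))"

definition positive_op :: "nat \<Rightarrow> complex mat \<Rightarrow> bool" where
  "positive_op n X \<longleftrightarrow> X \<in> carrier_mat n n \<and>
     (\<forall>v \<in> carrier_vec n. let q = (\<Sum>i<n. \<Sum>j<n. cnj (v $ i) * X $$ (i,j) * v $ j)
        in Im q = 0 \<and> Re q \<ge> 0)"

definition supp :: "complex mat \<Rightarrow> complex vec set" where
  "supp X = {X *\<^sub>v v | v. v \<in> carrier_vec (dim_col X)}"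

definition det_comb :: "(nat \<Rightarrow> nat) \<Rightarrow> nat \<Rightarrow> complex mat \<Rightarrow> bool" where
  "det_comb d N R \<longleftrightarrow> positive_op (dimp d (2*N)) R \<and>
     (\<exists>Rs :: nat \<Rightarrow> complex mat. Rs N = R \<and>
        (\<forall>n\<in>{1..N}. Rs n \<in> carrier_mat (dimp d (2*n)) (dimp d (2*n))) \<and>
        (\<forall>n\<in>{2..N}. ptrace_top (d (2*n-1)) (dimp d (2*n-1)) (Rs n)
                       = kron (1\<^sub>m (d (2*n-2))) (Rs (n-1))) \<and>
        ptrace_top (d 1) (d 0) (Rs 1) = 1\<^sub>m (d 0))"

definition sum_ops :: "nat \<Rightarrow> nat \<Rightarrow> (nat \<Rightarrow> complex mat) \<Rightarrow> complex mat" where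
  "sum_ops D M T = mat D D (\<lambda>ij. \<Sum>i\<in>{1..M}. T i $$ ij)"

definition gen_instrument :: "(nat \<Rightarrow> nat) \<Rightarrow> nat \<Rightarrow> nat \<Rightarrow> (nat \<Rightarrow> complex mat) \<Rightarrow> bool" where
  "gen_instrument d N M T \<longleftrightarrow>
     (\<forall>i\<in>{1..M}. positive_op (dimp d (2*N)) (T i)) \<and>
     det_comb d N (sum_ops (dimp d (2*N)) M T)"

definition extremal_instrument :: "(nat \<Rightarrow> nat) \<Rightarrow> nat \<Rightarrow> nat \<Rightarrow> (nat \<Rightarrow> complex mat) \<Rightarrow> bool" where
  "extremal_instrument d N M T \<longleftrightarrow> gen_instrument d N M T \<and>
     (\<forall>A B (t::real). gen_instrument d N M A \<and> gen_instrument d N M B \<and> 0 < t \<and> t < 1 \<and>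
        (\<forall>i\<in>{1..M}. T i = complex_of_real t \<cdot>\<^sub>m A i + complex_of_real (1 - t) \<cdot>\<^sub>m B i)
        \<longrightarrow> (\<forall>i\<in>{1..M}. A i = T i \<and> B i = T i))"

definition rlin_indep :: "nat \<Rightarrow> complex mat list \<Rightarrow> bool" where
  "rlin_indep n Bs \<longleftrightarrow> (\<forall>c :: nat \<Rightarrow> real.
     (\<forall>i<n. \<forall>j<n. (\<Sum>k<length Bs. complex_of_real (c k) * (Bs ! k) $$ (i,j)) = 0)
     \<longrightarrow> (\<forall>k<length Bs. c k = 0))"

definition in_rspan :: "nat \<Rightarrow> complex mat list \<Rightarrow> complex mat \<Rightarrow> bool" where
  "in_rspan n Bs X \<longleftrightarrow> (\<exists>c :: nat \<Rightarrow> real.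
     \<forall>i<n. \<forall>j<n. X $$ (i,j) = (\<Sum>k<length Bs. complex_of_real (c k) * (Bs ! k) $$ (i,j)))"

definition is_rbasis :: "nat \<Rightarrow> complex mat set \<Rightarrow> complex mat list \<Rightarrow> bool" where
  "is_rbasis n W Bs \<longleftrightarrow> set Bs \<subseteq> W \<and> rlin_indep n Bs \<and> (\<forall>X\<in>W. in_rspan n Bs X)"

definition herm_space :: "nat \<Rightarrow> complex mat set" where
  "herm_space n = {X. hermitian_op n X}"

definition traceless_herm_space :: "nat \<Rightarrow> complex mat set" where
  "traceless_herm_space n = {X. hermitian_op n X \<and> mtrace X = 0}"

definition herm_supp_space :: "nat \<Rightarrow> complex mat \<Rightarrow> complex mat set" where
  "herm_supp_space n T = {X. hermitian_op n X \<and> supp X \<subseteq> supp T}"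

text \<open>The family D_M = union of the H_i (as a family, i.e. with multiplicity).\<close>
definition DM_family :: "nat \<Rightarrow> (nat \<Rightarrow> complex mat list) \<Rightarrow> complex mat list" where
  "DM_family M Hs = concat (map Hs [1..<Suc M])"

definition DN_family :: "(nat \<Rightarrow> nat) \<Rightarrow> nat \<Rightarrow> (nat \<Rightarrow> complex mat list) \<Rightarrow> (nat \<Rightarrow> complex mat list)
     \<Rightarrow> complex mat list" where
  "DN_family d N Es Fs = concat (map (\<lambda>n.
      concat (map (\<lambda>E. map (\<lambda>F. kron (1\<^sub>m (\<Prod>k\<in>{2*n..<2*N}. d k)) (kron E F)) (Fs (2*n-2)))
        (Es (2*n-1)))) [1..<Suc N])"

end

theory Submission
  imports Defs "HOL-Library.Function_Algebras"
begin

text \<open>An instrument fails to be extremal iff it admits a nonzero perturbation \<open>T_i \<plusminus> \<epsilon> X_i\<close> within the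
  instruments. Positivity for small \<open>\<epsilon>\<close> means that \<open>X_i\<close> is hermitian with support in \<open>Supp(T_i)\<close>, i.e.
  \<open>X_i\<close> lies in the real span of \<open>H_i\<close>. The affine comb constraints mean that \<open>Y = \<Sum>_i X_i\<close> satisfies
  \<open>Tr_{2N-1} Y = I \<otimes> Y'\<close>, and so on down to \<open>Tr_1 Y^(1) = 0\<close>. Subtracting \<open>I \<otimes> I \<otimes> Y' / d_{2N-1}\<close> leaves
  an operator with \<open>Tr_{2N-1} = 0\<close>, which is a combination of the products \<open>E \<otimes> F\<close>; by induction on \<open>N\<close>
  these \<open>Y\<close> are exactly the span of \<open>D_(N)\<close>, and \<open>D_(N)\<close> is independent. Hence a nonzero
  perturbation is the same as a linear relation in the joint family.\<close>

section \<open>Positive operators and supports\<close>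

text \<open>No spectral decomposition is used. Whether T_i can absorb a small multiple of X_i is
  decided by comparing quadratic forms: a bound |<v, X_i v>| <= C <v, T_i v> for all v gives the
  admissible size of the perturbation. A generalized inverse of T_i derives this bound from the
  inclusion of supports. In the other direction, if T_i is a proper mixture of A_i and B_i, then
  both are dominated by multiples of T_i; this forces their ranges into Supp(T_i), so A_i - B_i lies
  in the span of H_i. A second obstacle is that coefficients are real while matrix entries, hence
  the blocks of a tensor product, are complex. The F are therefore used as a complex basis, and
  hermiticity brings the coefficients of E (x) F back to the reals. Each H_i and D_(N) is
  independent on its own, so a relation in the joint family is nontrivial exactly when some X_i is
  nonzero. This is why the union counts multiplicity: an element shared by two of the H_i already
  gives a nonzero perturbation.\<close>

definition ip :: "nat \<Rightarrow> (nat \<Rightarrow> complex) \<Rightarrow> (nat \<Rightarrow> complex) \<Rightarrow> complex" where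
  "ip n u v = (\<Sum>i<n. cnj (u i) * v i)"

definition mat_app :: "nat \<Rightarrow> complex mat \<Rightarrow> (nat \<Rightarrow> complex) \<Rightarrow> nat \<Rightarrow> complex" where
  "mat_app n X v i = (\<Sum>j<n. X $$ (i,j) * v j)"

definition norm_sq :: "nat \<Rightarrow> (nat \<Rightarrow> complex) \<Rightarrow> real" where
  "norm_sq n u = (\<Sum>i<n. (cmod (u i))\<^sup>2)"

abbreviation qf :: "nat \<Rightarrow> complex mat \<Rightarrow> (nat \<Rightarrow> complex) \<Rightarrow> complex" where
  "qf n X v \<equiv> ip n v (mat_app n X v)"

definition basis_fun :: "nat \<Rightarrow> nat \<Rightarrow> complex" where
  "basis_fun k i = (if i = k then 1 else 0)"

lemma ip_cong: "(\<And>i. i < n \<Longrightarrow> u i = u' i) \<Longrightarrow> (\<And>i. i < n \<Longrightarrow> v i = v' i) \<Longrightarrow> ip n u v = ip n u' v'"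
  unfolding ip_def by (intro sum.cong) auto

lemma mat_app_cong: "(\<And>i. i < n \<Longrightarrow> u i = u' i) \<Longrightarrow> mat_app n X u = mat_app n X u'"
  unfolding mat_app_def fun_eq_iff by (intro allI sum.cong) auto

lemma ip_self: "ip n u u = complex_of_real (norm_sq n u)"
  unfolding ip_def norm_sq_def of_real_sum
  by (intro sum.cong refl) (simp only: complex_norm_square mult.commute)

lemma norm_sq_nonneg: "0 \<le> norm_sq n u"
  unfolding norm_sq_def by (intro sum_nonneg) auto

lemma norm_sq_coord: "i < n \<Longrightarrow> (cmod (u i))\<^sup>2 \<le> norm_sq n u"
  unfolding norm_sq_def by (intro member_le_sum) auto

lemma norm_sq_eq_0D: "norm_sq n u \<le> 0 \<Longrightarrow> i < n \<Longrightarrow> u i = 0"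
  using order_trans[OF norm_sq_coord[of i n u], of 0] by auto

lemma ip_combo_left: "ip n (\<lambda>i. a * u i + b * v i) w = cnj a * ip n u w + cnj b * ip n v w"
  unfolding ip_def by (simp add: sum.distrib sum_distrib_left algebra_simps)

lemma ip_combo_right: "ip n w (\<lambda>i. a * u i + b * v i) = a * ip n w u + b * ip n w v"
  unfolding ip_def by (simp add: sum.distrib sum_distrib_left algebra_simps)

lemma mat_app_combo: "mat_app n X (\<lambda>i. a * u i + b * v i) = (\<lambda>i. a * mat_app n X u i + b * mat_app n X v i)"
  unfolding mat_app_def by (simp add: sum.distrib sum_distrib_left algebra_simps)

lemma ip_basis: assumes "k < n" shows "ip n (basis_fun k) v = v k"
proof -
  have "ip n (basis_fun k) v = (\<Sum>i<n. if i = k then v i else 0)"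
    unfolding ip_def basis_fun_def by (intro sum.cong) auto
  then show ?thesis using assms by simp
qed

lemma mat_app_basis: assumes "k < n" shows "mat_app n X (basis_fun k) i = X $$ (i,k)"
proof -
  have "mat_app n X (basis_fun k) i = (\<Sum>j<n. if j = k then X $$ (i,j) else 0)"
    unfolding mat_app_def basis_fun_def by (intro sum.cong) auto
  then show ?thesis using assms by simp
qed

text \<open>The form only sees the first \<open>n\<close> values of a function, so vectors of
  \<open>carrier_vec n\<close> can be traded for arbitrary functions
  \<open>nat \<Rightarrow> complex\<close>. All later arguments then run without carrier conditions
  on vectors.\<close>

lemma positive_op_iff:
  "positive_op n X \<longleftrightarrow> X \<in> carrier_mat n n \<and> (\<forall>v. Im (qf n X v) = 0 \<and> 0 \<le> Re (qf n X v))"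
proof -
  have *: "(\<Sum>i<n. \<Sum>j<n. cnj (v i) * X $$ (i,j) * v j) = qf n X v" for v
    unfolding ip_def mat_app_def by (simp add: sum_distrib_left mult.assoc)
  have 1: "(\<Sum>i<n. \<Sum>j<n. cnj (v $ i) * X $$ (i,j) * v $ j) = qf n X (\<lambda>i. v $ i)" for v
    by (rule *)
  have 2: "qf n X f = qf n X (\<lambda>i. vec n f $ i)" for f
    by (intro ip_cong mat_app_cong fun_cong[OF mat_app_cong]) auto
  show ?thesis
    unfolding positive_op_def Let_def 1
  proof (intro conj_cong refl iffI allI ballI conjI)
    fix v :: "nat \<Rightarrow> complex" assume *: "\<forall>v\<in>carrier_vec n. Im (qf n X (($) v)) = 0 \<and> 0 \<le> Re (qf n X (($) v))"
    show "Im (qf n X v) = 0" "0 \<le> Re (qf n X v)"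
      using bspec[OF *, of "vec n v"] by (simp_all add: 2[of v])
  qed auto
qed

lemma qf_add:
  "qf n X (\<lambda>i. u i + v i) = qf n X u + qf n X v + ip n u (mat_app n X v) + ip n v (mat_app n X u)"
  using mat_app_combo[of n X 1 u 1 v] ip_combo_left[of n 1 u 1 v] ip_combo_right[of n _ 1 _ 1]
  by (simp add: add_ac)

text \<open>Polarization: a real quadratic form has real cross terms. The pair e_i, e_j gives the
  imaginary parts of the two entries, the pair e_i, \<open>\<i>\<close> e_j their real
  parts.\<close>

lemma positive_op_hermitian:
  assumes "positive_op n X" shows "hermitian_op n X"
  unfolding hermitian_op_def
proof (intro conjI allI impI)
  show "X \<in> carrier_mat n n" using assms by (simp add: positive_op_iff)
  fix i j assume ij: "i < n" "j < n"
  have im: "Im (ip n u (mat_app n X v) + ip n v (mat_app n X u)) = 0" for u v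
  proof -
    have "Im (qf n X (\<lambda>i. u i + v i)) = 0" "Im (qf n X u) = 0" "Im (qf n X v) = 0"
      using assms by (auto simp: positive_op_iff)
    then show ?thesis unfolding qf_add by simp
  qed
  have b: "mat_app n X (\<lambda>k. \<i> * basis_fun j k) = (\<lambda>k. \<i> * X $$ (k,j))"
    "ip n (\<lambda>k. \<i> * basis_fun j k) w = - \<i> * w j" for w
    using mat_app_combo[of n X \<i> "basis_fun j" 0 "basis_fun j"]
      ip_combo_left[of n \<i> "basis_fun j" 0 "basis_fun j" w] ij
    by (simp_all add: mat_app_basis ip_basis)
  have "Im (X $$ (i,j) + X $$ (j,i)) = 0"
    using im[of "basis_fun i" "basis_fun j"] ij by (simp add: mat_app_basis ip_basis)
  moreover have "Im (\<i> * X $$ (i,j) - \<i> * X $$ (j,i)) = 0"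
    using im[of "basis_fun i" "\<lambda>k. \<i> * basis_fun j k"] ij by (simp add: mat_app_basis ip_basis b)
  ultimately show "X $$ (j,i) = cnj (X $$ (i,j))"
    by (simp add: complex_eq_iff)
qed

lemma hermitian_op_cnj: "hermitian_op n X \<Longrightarrow> i < n \<Longrightarrow> j < n \<Longrightarrow> cnj (X $$ (i,j)) = X $$ (j,i)"
  unfolding hermitian_op_def by metis

lemma hermitian_ip:
  assumes "hermitian_op n X"
  shows "ip n u (mat_app n X v) = ip n (mat_app n X u) v"
proof -
  have "ip n u (mat_app n X v) = (\<Sum>i<n. \<Sum>j<n. cnj (u i) * X $$ (i,j) * v j)"
    unfolding ip_def mat_app_def by (simp add: sum_distrib_left mult.assoc)
  also have "\<dots> = (\<Sum>j<n. \<Sum>i<n. cnj (u i) * X $$ (i,j) * v j)" by (rule sum.swap)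
  also have "\<dots> = (\<Sum>j<n. \<Sum>i<n. cnj (X $$ (j,i) * u i) * v j)"
    by (intro sum.cong refl) (simp add: hermitian_op_cnj[OF assms])
  also have "\<dots> = ip n (mat_app n X u) v"
    unfolding ip_def mat_app_def by (simp add: sum_distrib_right)
  finally show ?thesis .
qed

lemma hermitian_qf_real: "hermitian_op n X \<Longrightarrow> Im (qf n X v) = 0"
proof -
  assume "hermitian_op n X"
  then have "qf n X v = cnj (qf n X v)"
    using hermitian_ip[of n X v v] unfolding ip_def by (simp add: mult.commute)
  then have "Im (qf n X v) = - Im (qf n X v)" by (metis cnj.simps(2))
  then show ?thesis by simp
qed

text \<open>The entrywise estimate rests on 2 x y <= x^2 + y^2. The summand 1 in the constant keeps
  it positive for a zero matrix, because the constant is divided by later.\<close>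

lemma qf_bound: "\<exists>C>0. \<forall>v. cmod (qf n X v) \<le> C * norm_sq n v"
proof (intro exI[of _ "1 + (\<Sum>i<n. \<Sum>j<n. cmod (X $$ (i,j)))"] conjI allI)
  show "0 < 1 + (\<Sum>i<n. \<Sum>j<n. cmod (X $$ (i,j)))"
    by (intro add_pos_nonneg sum_nonneg) auto
  fix v
  have e: "cmod (cnj (v i) * (X $$ (i,j) * v j)) \<le> cmod (X $$ (i,j)) * norm_sq n v"
    if "i < n" "j < n" for i j
  proof -
    have "2 * (cmod (v i) * cmod (v j)) \<le> (cmod (v i))\<^sup>2 + (cmod (v j))\<^sup>2"
      using sum_squares_bound[of "cmod (v i)" "cmod (v j)"] by simp
    then have "cmod (v i) * cmod (v j) \<le> norm_sq n v"
      using norm_sq_coord[OF that(1), of v] norm_sq_coord[OF that(2), of v] by linarith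
    then have "cmod (X $$ (i,j)) * (cmod (v i) * cmod (v j)) \<le> cmod (X $$ (i,j)) * norm_sq n v"
      by (intro mult_left_mono) auto
    then show ?thesis by (simp add: norm_mult mult.left_commute)
  qed
  have "cmod (qf n X v) \<le> (\<Sum>i<n. \<Sum>j<n. cmod (X $$ (i,j)) * norm_sq n v)"
    unfolding ip_def mat_app_def sum_distrib_left
    by (intro sum_norm_le e) auto
  also have "\<dots> \<le> (1 + (\<Sum>i<n. \<Sum>j<n. cmod (X $$ (i,j)))) * norm_sq n v"
    by (simp add: sum_distrib_right distrib_right norm_sq_nonneg)
  finally show "cmod (qf n X v) \<le> (1 + (\<Sum>i<n. \<Sum>j<n. cmod (X $$ (i,j)))) * norm_sq n v" .
qed

lemma norm_sq_mat_app_bound: "\<exists>C>0. \<forall>v. norm_sq n (mat_app n X v) \<le> C * norm_sq n v"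
proof (intro exI[of _ "1 + (\<Sum>i<n. (\<Sum>j<n. cmod (X $$ (i,j)))\<^sup>2)"] conjI allI)
  show "0 < 1 + (\<Sum>i<n. (\<Sum>j<n. cmod (X $$ (i,j)))\<^sup>2)"
    by (intro add_pos_nonneg sum_nonneg) auto
  fix v
  have "(cmod (mat_app n X v i))\<^sup>2 \<le> (\<Sum>j<n. cmod (X $$ (i,j)))\<^sup>2 * norm_sq n v" for i
  proof -
    have "cmod (mat_app n X v i) \<le> (\<Sum>j<n. cmod (X $$ (i,j)) * sqrt (norm_sq n v))"
      unfolding mat_app_def
      by (intro sum_norm_le) (auto simp: norm_mult intro!: mult_left_mono real_le_rsqrt norm_sq_coord)
    then have "cmod (mat_app n X v i) \<le> (\<Sum>j<n. cmod (X $$ (i,j))) * sqrt (norm_sq n v)"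
      by (simp add: sum_distrib_right)
    then have "(cmod (mat_app n X v i))\<^sup>2 \<le> ((\<Sum>j<n. cmod (X $$ (i,j))) * sqrt (norm_sq n v))\<^sup>2"
      by (intro power_mono) auto
    then show ?thesis by (simp add: power_mult_distrib norm_sq_nonneg)
  qed
  then have "norm_sq n (mat_app n X v) \<le> (\<Sum>i<n. (\<Sum>j<n. cmod (X $$ (i,j)))\<^sup>2 * norm_sq n v)"
    unfolding norm_sq_def[of n "mat_app n X v"] by (intro sum_mono)
  also have "\<dots> \<le> (1 + (\<Sum>i<n. (\<Sum>j<n. cmod (X $$ (i,j)))\<^sup>2)) * norm_sq n v"
    by (simp add: sum_distrib_right distrib_right norm_sq_nonneg)
  finally show "norm_sq n (mat_app n X v) \<le> (1 + (\<Sum>i<n. (\<Sum>j<n. cmod (X $$ (i,j)))\<^sup>2)) * norm_sq n v" .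
qed

text \<open>Positivity at v - x X v gives 0 <= <v, X v> - 2 x |X v|^2 + x^2 C |X v|^2, where
  \<open>C\<close> bounds the form of \<open>X\<close>. This replaces an argument with the square
  root of \<open>X\<close>; in particular a vector with vanishing form is in the kernel.\<close>

lemma positive_op_norm_sq_le_qf:
  assumes "positive_op n X"
  shows "\<exists>C>0. \<forall>v. norm_sq n (mat_app n X v) \<le> C * Re (qf n X v)"
proof -
  obtain C where C: "C > 0" "\<And>v. cmod (qf n X v) \<le> C * norm_sq n v" using qf_bound by blast
  have "norm_sq n (mat_app n X v) \<le> C * Re (qf n X v)" for v
  proof -
    let ?w = "mat_app n X v"
    \<comment> \<open>The value x = 1/C minimizes -2 x + C x^2.\<close>
    define s where "s = - complex_of_real (1 / C)"
    have cs: "cnj s = s" by (simp add: s_def)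
    have m: "mat_app n X (\<lambda>i. s * ?w i) = (\<lambda>i. s * mat_app n X ?w i)"
      using mat_app_combo[of n X s ?w 0 ?w] by simp
    have "qf n X (\<lambda>i. v i + s * ?w i) = qf n X v + s * s * qf n X ?w + 2 * s * norm_sq n ?w"
      using qf_add[of n v "\<lambda>i. s * ?w i" X]
        ip_combo_left[of n s ?w 0 ?w] ip_combo_right[of n _ s _ 0]
        hermitian_ip[OF positive_op_hermitian[OF assms], of v ?w]
      by (simp add: m cs ip_self algebra_simps)
    moreover have "0 \<le> Re (qf n X (\<lambda>i. v i + s * ?w i))" using assms by (simp add: positive_op_iff)
    ultimately have "0 \<le> Re (qf n X v) + (1/C) * (1/C) * Re (qf n X ?w) - 2 * (1/C) * norm_sq n ?w"
      by (simp add: s_def)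
    moreover have "Re (qf n X ?w) \<le> C * norm_sq n ?w"
      using C(2)[of ?w] complex_Re_le_cmod order_trans by blast
    then have "(1/C) * (1/C) * Re (qf n X ?w) \<le> (1/C) * (1/C) * (C * norm_sq n ?w)"
      using C(1) by (intro mult_left_mono) auto
    ultimately have "(1/C) * norm_sq n ?w \<le> Re (qf n X v)" using C(1) by simp
    then show ?thesis using C(1) by (simp add: field_simps)
  qed
  then show ?thesis using C(1) by blast
qed

section \<open>Generalized inverses and comparison of quadratic forms\<close>

interpretation cfun: vector_space "\<lambda>(c::complex) (f::nat \<Rightarrow> complex). (\<lambda>i. c * f i)"
  by unfold_locales (auto simp: fun_eq_iff algebra_simps)

interpretation cfun_pair: vector_space_pair
  "\<lambda>(c::complex) (f::nat \<Rightarrow> complex). (\<lambda>i. c * f i)" "\<lambda>(c::complex) (f::nat \<Rightarrow> complex). (\<lambda>i. c * f i)"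
  by unfold_locales

lemma sum_fun_apply: "(\<Sum>x\<in>A. f x) i = (\<Sum>x\<in>A. f x i)"
  by (induction A rule: infinite_finite_induct) auto

text \<open>The matrix, cut off to 0 from index \<open>n\<close> on, is a linear map on the space of
  all functions \<open>nat \<Rightarrow> complex\<close>, and a linear map has a linear right
  inverse on its range. The first \<open>n\<close> columns of that inverse form \<open>G\<close>,
  with X G X = X.\<close>

lemma ex_generalized_inverse:
  "\<exists>G. \<forall>v. \<forall>i<n. mat_app n X (mat_app n G (mat_app n X v)) i = mat_app n X v i"
proof -
  have lin: "Vector_Spaces.linear (\<lambda>c f i. c * f i) (\<lambda>c f i. c * f i)
     (\<lambda>v i. if i < n then mat_app n X v i else 0)" 
    by unfold_locales (auto simp: mat_app_def fun_eq_iff algebra_simps sum.distrib sum_distrib_left)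
  let ?f = "\<lambda>v i. if i < n then mat_app n X v i else 0"
  obtain g where g: "Vector_Spaces.linear (\<lambda>c f i. c * f i) (\<lambda>c f i. c * f i) g"
    and gf: "\<And>v. ?f (g (?f v)) = ?f v"
    using cfun_pair.linear_exists_right_inverse_on[OF lin cfun.subspace_UNIV] by blast
  interpret g: Vector_Spaces.linear "\<lambda>(c::complex) (f::nat \<Rightarrow> complex). (\<lambda>i. c * f i)"
    "\<lambda>(c::complex) (f::nat \<Rightarrow> complex). (\<lambda>i. c * f i)" g by (rule g)
  define G where "G = mat n n (\<lambda>(i,j). g (basis_fun j) i)"
  \<comment> \<open>Thanks to the cut-off, \<open>?f v\<close> is a finite combination of the basis
    functions below \<open>n\<close>, so linearity of \<open>g\<close> reduces it to the columns
    stored in \<open>G\<close>.\<close>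
  have gG: "g (?f v) i = mat_app n G (mat_app n X v) i" if "i < n" for v i
  proof -
    have "(\<Sum>j<n. mat_app n X v j * basis_fun j k) = (\<Sum>j<n. if j = k then mat_app n X v j else 0)" for k
      unfolding basis_fun_def by (intro sum.cong) auto
    then have "?f v = (\<Sum>j<n. (\<lambda>i. mat_app n X v j * basis_fun j i))"
      by (simp add: fun_eq_iff sum_fun_apply)
    then have "g (?f v) i = (\<Sum>j<n. mat_app n X v j * g (basis_fun j) i)"
      by (simp add: g.sum g.scale sum_fun_apply)
    moreover have "G $$ (i,j) = g (basis_fun j) i" if "j < n" for j
      using that \<open>i < n\<close> by (simp add: G_def)
    ultimately show ?thesis unfolding mat_app_def[of n G] by (simp add: mult.commute)
  qed
  have "mat_app n X (mat_app n G (mat_app n X v)) i = mat_app n X v i" if "i < n" for v i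
  proof -
    have "mat_app n X (mat_app n G (mat_app n X v)) = mat_app n X (g (?f v))"
      by (intro mat_app_cong) (simp add: gG)
    then show ?thesis using fun_cong[OF gf[of v], of i] that by simp
  qed
  then show ?thesis by blast
qed

text \<open>If \<open>range D \<subseteq> range X\<close>, then \<open>D\<close> also vanishes on the kernel of \<open>X\<close>, so with a
  generalized inverse \<open>G\<close> of \<open>X\<close> the form of \<open>D\<close> at \<open>v\<close> equals its form at \<open>G X v\<close>.\<close>

lemma qf_dominated:
  assumes X: "positive_op n X" and D: "hermitian_op n D"
    and supp: "\<And>v. \<exists>w. \<forall>i<n. mat_app n D v i = mat_app n X w i"
  shows "\<exists>C>0. \<forall>v. cmod (qf n D v) \<le> C * Re (qf n X v)"
proof -
  note hX = positive_op_hermitian[OF X]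
  obtain G where G: "\<And>v i. i < n \<Longrightarrow> mat_app n X (mat_app n G (mat_app n X v)) i = mat_app n X v i"
    using ex_generalized_inverse by blast
  \<comment> \<open>With D u = X w, the pairing moves as <u, D v> = <X w, v> = <w, X v>.\<close>
  have ker: "ip n u (mat_app n D v) = 0" if "\<And>i. i < n \<Longrightarrow> mat_app n X v i = 0" for u v
  proof -
    obtain w where w: "\<And>i. i < n \<Longrightarrow> mat_app n D u i = mat_app n X w i" using supp by blast
    have "ip n u (mat_app n D v) = ip n (mat_app n X w) v"
      unfolding hermitian_ip[OF D, of u v] by (intro ip_cong w) auto
    also have "\<dots> = ip n w (mat_app n X v)" by (simp add: hermitian_ip[OF hX])
    also have "\<dots> = 0" using that by (simp add: ip_def)
    finally show ?thesis .
  qed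
  have eq: "qf n D v = qf n D (mat_app n G (mat_app n X v))" for v
  proof -
    define r where "r = mat_app n G (mat_app n X v)"
    define z where "z = (\<lambda>i. v i - r i)"
    have "mat_app n X z i = 0" if "i < n" for i
      using G[OF that, of v] fun_cong[OF mat_app_combo[of n X 1 v "-1" r], of i] by (simp add: z_def r_def)
    then have k: "ip n u (mat_app n D z) = 0" for u by (rule ker)
    have "mat_app n D z i = 0" if "i < n" for i using k[of "basis_fun i"] that by (simp add: ip_basis)
    then have k': "ip n z (mat_app n D r) = 0" unfolding hermitian_ip[OF D, of z r] by (simp add: ip_def)
    have "qf n D (\<lambda>i. r i + z i) = qf n D r"
      unfolding qf_add using k[of r] k[of z] k' by simp
    then show ?thesis by (simp add: z_def r_def)
  qed
  obtain C1 where C1: "C1 > 0" "\<And>v. norm_sq n (mat_app n X v) \<le> C1 * Re (qf n X v)"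
    using positive_op_norm_sq_le_qf[OF X] by blast
  obtain C2 where C2: "C2 > 0" "\<And>v. norm_sq n (mat_app n G v) \<le> C2 * norm_sq n v"
    using norm_sq_mat_app_bound by blast
  obtain C3 where C3: "C3 > 0" "\<And>v. cmod (qf n D v) \<le> C3 * norm_sq n v"
    using qf_bound by blast
  \<comment> \<open>The passage from v to G X v makes the norm of X v appear, and that norm is
    controlled by the form of \<open>X\<close>, whereas the norm of v is not.\<close>
  have "cmod (qf n D v) \<le> (C3 * (C2 * C1)) * Re (qf n X v)" for v
  proof -
    have "cmod (qf n D v) \<le> C3 * norm_sq n (mat_app n G (mat_app n X v))" unfolding eq[of v] by (rule C3)
    also have "\<dots> \<le> C3 * (C2 * norm_sq n (mat_app n X v))" using C3(1) by (intro mult_left_mono C2) auto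
    also have "\<dots> \<le> C3 * (C2 * (C1 * Re (qf n X v)))" using C3(1) C2(1) by (intro mult_left_mono C1) auto
    finally show ?thesis by (simp add: mult.assoc)
  qed
  then show ?thesis using C1(1) C2(1) C3(1) by (intro exI[of _ "C3 * (C2 * C1)"]) auto
qed

text \<open>Domination puts the kernel of \<open>X\<close> inside the kernel of \<open>A\<close>,
  hence A = A G X for a generalized inverse \<open>G\<close>. Taking adjoints gives A = X G* A,
  which exhibits the preimage under \<open>X\<close>.\<close>

lemma dominated_range:
  assumes X: "positive_op n X" and A: "positive_op n A"
    and le: "\<And>v. Re (qf n A v) \<le> c * Re (qf n X v)"
  shows "\<exists>w. \<forall>i<n. mat_app n A v i = mat_app n X w i"
proof -
  note hX = positive_op_hermitian[OF X] and hA = positive_op_hermitian[OF A]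
  obtain G where G: "\<And>v i. i < n \<Longrightarrow> mat_app n X (mat_app n G (mat_app n X v)) i = mat_app n X v i"
    using ex_generalized_inverse by blast
  obtain C where C: "C > 0" "\<And>v. norm_sq n (mat_app n A v) \<le> C * Re (qf n A v)"
    using positive_op_norm_sq_le_qf[OF A] by blast
  have ker: "mat_app n A z i = 0" if "\<And>i. i < n \<Longrightarrow> mat_app n X z i = 0" "i < n" for z i
  proof -
    have "qf n X z = 0" using that(1) by (simp add: ip_def)
    then have "Re (qf n A z) \<le> 0" using le[of z] by simp
    then have "C * Re (qf n A z) \<le> 0" using C(1) by (simp add: mult_le_0_iff)
    then have "norm_sq n (mat_app n A z) \<le> 0" using C(2)[of z] by linarith
    then show ?thesis using that(2) by (rule norm_sq_eq_0D)
  qed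
  have AG: "mat_app n A u i = mat_app n A (mat_app n G (mat_app n X u)) i" if "i < n" for u i
  proof -
    let ?z = "\<lambda>i. 1 * u i + (-1) * mat_app n G (mat_app n X u) i"
    have "mat_app n X ?z i = 0" if "i < n" for i
      using G[OF that, of u] unfolding mat_app_combo by simp
    then have "mat_app n A ?z i = 0" using that by (rule ker)
    then show ?thesis unfolding mat_app_combo by simp
  qed
  \<comment> \<open>The adjoint of \<open>G\<close>, which is in general not hermitian.\<close>
  define Gs where "Gs = mat n n (\<lambda>(i,j). cnj (G $$ (j,i)))"
  have Gs: "ip n (mat_app n G u) w = ip n u (mat_app n Gs w)" for u w
  proof -
    have "ip n (mat_app n G u) w = (\<Sum>i<n. \<Sum>j<n. cnj (u j) * (cnj (G $$ (i,j)) * w i))"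
      unfolding ip_def mat_app_def by (simp add: sum_distrib_right sum_distrib_left mult_ac)
    also have "\<dots> = (\<Sum>j<n. \<Sum>i<n. cnj (u j) * (cnj (G $$ (i,j)) * w i))" by (rule sum.swap)
    also have "\<dots> = ip n u (mat_app n Gs w)"
      unfolding ip_def mat_app_def sum_distrib_left Gs_def by (intro sum.cong) auto
    finally show ?thesis .
  qed
  have "mat_app n A v i = mat_app n X (mat_app n Gs (mat_app n A v)) i" if "i < n" for i
  proof -
    have "ip n u (mat_app n A v) = ip n u (mat_app n X (mat_app n Gs (mat_app n A v)))" for u
    proof -
      have "ip n u (mat_app n A v) = ip n (mat_app n A (mat_app n G (mat_app n X u))) v"
        unfolding hermitian_ip[OF hA, of u v] by (intro ip_cong AG) auto
      also have "\<dots> = ip n (mat_app n G (mat_app n X u)) (mat_app n A v)" by (simp add: hermitian_ip[OF hA])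
      also have "\<dots> = ip n u (mat_app n X (mat_app n Gs (mat_app n A v)))"
        by (simp add: Gs hermitian_ip[OF hX])
      finally show ?thesis .
    qed
    from this[of "basis_fun i"] show ?thesis using that by (simp add: ip_basis)
  qed
  then show ?thesis by blast
qed

section \<open>Supports, perturbations and convex mixtures\<close>

lemma mult_mat_vec_mat_app:
  "X \<in> carrier_mat n n \<Longrightarrow> v \<in> carrier_vec n \<Longrightarrow> i < n \<Longrightarrow> (X *\<^sub>v v) $ i = mat_app n X (($) v) i"
  by (simp add: mat_app_def scalar_prod_def atLeast0LessThan)

text \<open>Translates \<open>supp\<close> into the range condition on functions that
  \<open>qf_dominated\<close> takes and \<open>dominated_range\<close> delivers.\<close>

lemma supp_subset_iff:
  assumes "X \<in> carrier_mat n n" "Y \<in> carrier_mat n n"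
  shows "supp Y \<subseteq> supp X \<longleftrightarrow> (\<forall>v. \<exists>w. \<forall>i<n. mat_app n Y v i = mat_app n X w i)"
proof
  assume sub: "supp Y \<subseteq> supp X"
  show "\<forall>v. \<exists>w. \<forall>i<n. mat_app n Y v i = mat_app n X w i"
  proof
    fix v
    have "Y *\<^sub>v vec n v \<in> supp Y" using assms by (auto simp: supp_def)
    then obtain w where w: "w \<in> carrier_vec n" "Y *\<^sub>v vec n v = X *\<^sub>v w"
      using sub assms by (auto simp: supp_def)
    have "mat_app n Y v i = mat_app n X (($) w) i" if "i < n" for i
    proof -
      have "mat_app n Y v = mat_app n Y (($) (vec n v))" by (intro mat_app_cong) simp
      then show ?thesis using mult_mat_vec_mat_app[OF assms(2), of "vec n v" i] w that
        mult_mat_vec_mat_app[OF assms(1), of w i] by simp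
    qed
    then show "\<exists>w. \<forall>i<n. mat_app n Y v i = mat_app n X w i" by blast
  qed
next
  assume R: "\<forall>v. \<exists>w. \<forall>i<n. mat_app n Y v i = mat_app n X w i"
  show "supp Y \<subseteq> supp X"
  proof
    fix y assume "y \<in> supp Y"
    then obtain v where v: "v \<in> carrier_vec n" "y = Y *\<^sub>v v" using assms by (auto simp: supp_def)
    obtain w where w: "\<And>i. i < n \<Longrightarrow> mat_app n Y (($) v) i = mat_app n X w i" using R by blast
    have "y = X *\<^sub>v vec n w"
    proof (rule eq_vecI)
      fix i assume "i < dim_vec (X *\<^sub>v vec n w)"
      then have i: "i < n" using assms by simp
      have "mat_app n X w = mat_app n X (($) (vec n w))" by (intro mat_app_cong) simp
      then show "y $ i = (X *\<^sub>v vec n w) $ i"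
        using w[OF i] v i mult_mat_vec_mat_app[OF assms(2) v(1) i]
          mult_mat_vec_mat_app[OF assms(1), of "vec n w" i] by simp
    qed (use v assms in simp)
    then show "y \<in> supp X" using assms by (auto simp: supp_def)
  qed
qed

text \<open>Binary sums and differences of matrices are written
  \<open>a \<cdot>\<^sub>m A + b \<cdot>\<^sub>m B\<close> below even when a coefficient is 1, so
  that the rules for this one shape apply.\<close>

lemma mat_app_mat_combo:
  assumes "A \<in> carrier_mat n n" "B \<in> carrier_mat n n" "i < n"
  shows "mat_app n (a \<cdot>\<^sub>m A + b \<cdot>\<^sub>m B) v i = a * mat_app n A v i + b * mat_app n B v i"
  using assms by (simp add: mat_app_def sum_distrib_left sum.distrib algebra_simps)

lemma qf_mat_combo:
  assumes "A \<in> carrier_mat n n" "B \<in> carrier_mat n n"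
  shows "qf n (a \<cdot>\<^sub>m A + b \<cdot>\<^sub>m B) v = a * qf n A v + b * qf n B v"
proof -
  have "qf n (a \<cdot>\<^sub>m A + b \<cdot>\<^sub>m B) v = ip n v (\<lambda>i. a * mat_app n A v i + b * mat_app n B v i)"
    by (intro ip_cong mat_app_mat_combo assms) auto
  then show ?thesis by (simp add: ip_combo_right)
qed

lemma hermitian_op_combo:
  fixes a b :: real
  assumes "hermitian_op n A" "hermitian_op n B"
  shows "hermitian_op n (complex_of_real a \<cdot>\<^sub>m A + complex_of_real b \<cdot>\<^sub>m B)"
  using assms hermitian_op_cnj[OF assms(1)] hermitian_op_cnj[OF assms(2)]
  unfolding hermitian_op_def by auto

text \<open>If |<v, D v>| <= C <v, X v>, then \<open>X\<close> outweighs s D as long as |s| <= 1/C.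
  Both signs of \<open>s\<close> are covered, which is what makes \<open>X\<close> a
  midpoint.\<close>

lemma positive_op_perturb:
  assumes X: "positive_op n X" and D: "D \<in> herm_supp_space n X"
  shows "\<exists>e>0. \<forall>s. \<bar>s\<bar> \<le> e \<longrightarrow> positive_op n (1 \<cdot>\<^sub>m X + complex_of_real s \<cdot>\<^sub>m D)"
proof -
  have D': "hermitian_op n D" "supp D \<subseteq> supp X" using D by (auto simp: herm_supp_space_def)
  have c: "X \<in> carrier_mat n n" "D \<in> carrier_mat n n"
    using X D' by (auto simp: positive_op_def hermitian_op_def)
  obtain C where C: "C > 0" "\<And>v. cmod (qf n D v) \<le> C * Re (qf n X v)"
    using qf_dominated[OF X D'(1)] D'(2) supp_subset_iff[OF c] by blast
  have "positive_op n (1 \<cdot>\<^sub>m X + complex_of_real s \<cdot>\<^sub>m D)" if s: "\<bar>s\<bar> \<le> 1 / C" for s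
    unfolding positive_op_iff
  proof (intro conjI allI)
    fix v
    show "Im (qf n (1 \<cdot>\<^sub>m X + complex_of_real s \<cdot>\<^sub>m D) v) = 0"
      using X hermitian_qf_real[OF D'(1), of v] by (simp add: qf_mat_combo[OF c] positive_op_iff)
    have "\<bar>s * Re (qf n D v)\<bar> \<le> (1 / C) * (C * Re (qf n X v))"
      unfolding abs_mult using s C abs_Re_le_cmod[of "qf n D v"]
      by (intro mult_mono order_trans[OF abs_Re_le_cmod]) auto
    then show "0 \<le> Re (qf n (1 \<cdot>\<^sub>m X + complex_of_real s \<cdot>\<^sub>m D) v)"
      using C(1) by (simp add: qf_mat_combo[OF c])
  qed (use c in auto)
  then show ?thesis using C(1) by (intro exI[of _ "1 / C"]) auto
qed

text \<open>The mixture X = t A + (1 - t) B dominates both parts: A <= X / t and B <= X / (1 - t).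
  So the ranges of \<open>A\<close> and \<open>B\<close>, and with them that of A - B, lie in the
  range of \<open>X\<close>.\<close>

lemma convex_diff_in_herm_supp_space:
  assumes A: "positive_op n A" and B: "positive_op n B" and t: "0 < t" "t < 1"
  shows "1 \<cdot>\<^sub>m A + (-1) \<cdot>\<^sub>m B
    \<in> herm_supp_space n (complex_of_real t \<cdot>\<^sub>m A + complex_of_real (1 - t) \<cdot>\<^sub>m B)"
    (is "?D \<in> herm_supp_space n ?X")
proof -
  have c: "A \<in> carrier_mat n n" "B \<in> carrier_mat n n" using A B by (auto simp: positive_op_def)
  have q: "qf n ?X v = t * qf n A v + (1 - t) * qf n B v" for v
    using qf_mat_combo[OF c, of v t "1 - t"] by simp
  have pos: "0 \<le> Re (qf n A v)" "0 \<le> Re (qf n B v)" "Im (qf n A v) = 0" "Im (qf n B v) = 0" for v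
    using A B by (auto simp: positive_op_iff)
  have X: "positive_op n ?X"
    unfolding positive_op_iff q using c t pos by auto
  have "Re (qf n A v) \<le> (1 / t) * Re (qf n ?X v)" for v
    unfolding q using t pos[of v] mult_right_mono[of t 1 "Re (qf n B v)"] by (simp add: field_simps)
  note rA = dominated_range[OF X A this]
  have "Re (qf n B v) \<le> (1 / (1 - t)) * Re (qf n ?X v)" for v
    unfolding q using t pos[of v] by (simp add: field_simps)
  note rB = dominated_range[OF X B this]
  have "\<exists>w. \<forall>i<n. mat_app n ?D v i = mat_app n ?X w i" for v
  proof -
    obtain w1 w2 where "\<forall>i<n. mat_app n A v i = mat_app n ?X w1 i" "\<forall>i<n. mat_app n B v i = mat_app n ?X w2 i"
      using rA rB by metis
    then have "\<forall>i<n. mat_app n ?D v i = mat_app n ?X (\<lambda>i. 1 * w1 i + (-1) * w2 i) i"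
      unfolding mat_app_combo by (simp add: mat_app_mat_combo[OF c] del: of_real_diff)
    then show ?thesis by blast
  qed
  then have "supp ?D \<subseteq> supp ?X" using c by (subst supp_subset_iff[of _ n]) auto
  moreover have "hermitian_op n ?D"
    using hermitian_op_combo[OF positive_op_hermitian[OF A] positive_op_hermitian[OF B], of 1 "-1"] by simp
  ultimately show ?thesis by (simp add: herm_supp_space_def)
qed

section \<open>Real combinations of lists of matrices\<close>

text \<open>The sum common to \<open>rlin_indep\<close> and \<open>in_rspan\<close>, kept entrywise
  so that no dimensions have to be tracked. Values of \<open>c\<close> from \<open>length Bs\<close>
  on are irrelevant.\<close>

definition lin_combo :: "(nat \<Rightarrow> real) \<Rightarrow> complex mat list \<Rightarrow> nat \<Rightarrow> nat \<Rightarrow> complex" where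
  "lin_combo c Bs i j = (\<Sum>k<length Bs. complex_of_real (c k) * (Bs ! k) $$ (i,j))"

lemma rlin_indep_lin_combo:
  "rlin_indep n Bs \<longleftrightarrow> (\<forall>c. (\<forall>i<n. \<forall>j<n. lin_combo c Bs i j = 0) \<longrightarrow> (\<forall>k<length Bs. c k = 0))"
  by (simp add: rlin_indep_def lin_combo_def)

lemma in_rspan_lin_combo: "in_rspan n Bs X \<longleftrightarrow> (\<exists>c. \<forall>i<n. \<forall>j<n. X $$ (i,j) = lin_combo c Bs i j)"
  by (simp add: in_rspan_def lin_combo_def)

lemma lin_combo_combo: "lin_combo (\<lambda>k. a * c k + b * e k) Bs i j = complex_of_real a * lin_combo c Bs i j + complex_of_real b * lin_combo e Bs i j"
  by (simp add: lin_combo_def sum.distrib sum_distrib_left algebra_simps)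

lemma lin_combo_eq_0: "(\<And>k. k < length Bs \<Longrightarrow> c k = 0) \<Longrightarrow> lin_combo c Bs i j = 0"
  by (simp add: lin_combo_def)

lemma sum_lessThan_add:
  fixes f :: "nat \<Rightarrow> 'a::comm_monoid_add"
  shows "(\<Sum>k<a + b. f k) = (\<Sum>k<a. f k) + (\<Sum>k<b. f (a + k))"
  by (induction b) (auto simp: add.assoc)

lemma lin_combo_append: "lin_combo c (xs @ ys) i j = lin_combo c xs i j + lin_combo (\<lambda>k. c (length xs + k)) ys i j"
  unfolding lin_combo_def length_append sum_lessThan_add
  by (intro arg_cong2[where f = "(+)"] sum.cong) (auto simp: nth_append)

definition join_coeffs :: "nat \<Rightarrow> (nat \<Rightarrow> real) \<Rightarrow> (nat \<Rightarrow> real) \<Rightarrow> nat \<Rightarrow> real" where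
  "join_coeffs m c e k = (if k < m then c k else e (k - m))"

lemma lin_combo_join_coeffs: "lin_combo (join_coeffs (length xs) c e) (xs @ ys) i j = lin_combo c xs i j + lin_combo e ys i j"
  unfolding lin_combo_append by (intro arg_cong2[where f = "(+)"]) (simp_all add: lin_combo_def join_coeffs_def)

lemma all_less_add: "(\<forall>k<a + b. P k) \<longleftrightarrow> (\<forall>k<a. P k) \<and> (\<forall>k<b. P (a + k :: nat))"
proof (intro iffI conjI allI impI)
  fix k assume R: "(\<forall>k<a. P k) \<and> (\<forall>k<b. P (a + k))" and k: "k < a + b"
  show "P k"
  proof (cases "k < a")
    case False
    then have "P (a + (k - a))" using R k by (intro R[THEN conjunct2, rule_format]) auto
    then show ?thesis using False by simp
  qed (use R in blast)
qed auto

lemma rlin_indep_append: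
  "rlin_indep n (xs @ ys) \<longleftrightarrow> (\<forall>c e. (\<forall>i<n. \<forall>j<n. lin_combo c xs i j + lin_combo e ys i j = 0)
     \<longrightarrow> (\<forall>k<length xs. c k = 0) \<and> (\<forall>k<length ys. e k = 0))"
proof
  assume L: "rlin_indep n (xs @ ys)"
  show "\<forall>c e. (\<forall>i<n. \<forall>j<n. lin_combo c xs i j + lin_combo e ys i j = 0)
     \<longrightarrow> (\<forall>k<length xs. c k = 0) \<and> (\<forall>k<length ys. e k = 0)"
  proof (intro allI impI)
    fix c e assume "\<forall>i<n. \<forall>j<n. lin_combo c xs i j + lin_combo e ys i j = 0"
    then have "\<forall>k<length (xs @ ys). join_coeffs (length xs) c e k = 0"
      using L unfolding rlin_indep_lin_combo by (simp add: lin_combo_join_coeffs del: length_append)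
    then show "(\<forall>k<length xs. c k = 0) \<and> (\<forall>k<length ys. e k = 0)"
      unfolding length_append all_less_add by (simp add: join_coeffs_def)
  qed
next
  assume R: "\<forall>c e. (\<forall>i<n. \<forall>j<n. lin_combo c xs i j + lin_combo e ys i j = 0)
     \<longrightarrow> (\<forall>k<length xs. c k = 0) \<and> (\<forall>k<length ys. e k = 0)"
  show "rlin_indep n (xs @ ys)"
    unfolding rlin_indep_lin_combo lin_combo_append length_append all_less_add using R by blast
qed

section \<open>Coefficients of the concatenated family \<open>DM_family\<close>\<close>

lemma DM_family_0: "DM_family 0 Hs = []" and
  DM_family_Suc: "DM_family (Suc M) Hs = DM_family M Hs @ Hs (Suc M)"
  by (simp_all add: DM_family_def)

text \<open>Cuts one coefficient sequence into a sequence per block. The vanishing clause goes from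
  the pieces back to the whole, the direction needed to prove independence.\<close>

lemma lin_combo_DM_family_split:
  "\<exists>c'. (\<forall>i j. lin_combo c (DM_family M Hs) i j = (\<Sum>m\<in>{1..M}. lin_combo (c' m) (Hs m) i j)) \<and>
     ((\<forall>m\<in>{1..M}. \<forall>k<length (Hs m). c' m k = 0) \<longrightarrow> (\<forall>k<length (DM_family M Hs). c k = 0))"
proof (induction M)
  case 0
  then show ?case by (simp add: DM_family_0 lin_combo_def)
next
  case (Suc M)
  then obtain c' where c': "\<And>i j. lin_combo c (DM_family M Hs) i j = (\<Sum>m\<in>{1..M}. lin_combo (c' m) (Hs m) i j)"
    "(\<forall>m\<in>{1..M}. \<forall>k<length (Hs m). c' m k = 0) \<Longrightarrow> (\<forall>k<length (DM_family M Hs). c k = 0)"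
    by blast
  \<comment> \<open>The last block starts at offset \<open>length (DM_family M Hs)\<close>.\<close>
  let ?c = "c'(Suc M := \<lambda>k. c (length (DM_family M Hs) + k))"
  have e: "(\<Sum>m\<in>{1..M}. lin_combo (?c m) (Hs m) i j) = (\<Sum>m\<in>{1..M}. lin_combo (c' m) (Hs m) i j)" for i j
    by (intro sum.cong) auto
  show ?case
  proof (intro exI[of _ ?c] conjI allI impI)
    fix i j show "lin_combo c (DM_family (Suc M) Hs) i j = (\<Sum>m\<in>{1..Suc M}. lin_combo (?c m) (Hs m) i j)"
      unfolding DM_family_Suc lin_combo_append c' using e[of i j] by simp
  next
    fix k assume z: "\<forall>m\<in>{1..Suc M}. \<forall>k<length (Hs m). ?c m k = 0"
      and k: "k < length (DM_family (Suc M) Hs)"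
    have "\<forall>m\<in>{1..M}. \<forall>k<length (Hs m). c' m k = 0"
    proof
      fix m assume "m \<in> {1..M}" then show "\<forall>k<length (Hs m). c' m k = 0" using z[rule_format, of m] by auto
    qed
    then have "\<forall>k<length (DM_family M Hs). c k = 0" by (rule c'(2))
    moreover have "\<forall>k<length (Hs (Suc M)). c (length (DM_family M Hs) + k) = 0"
      using z[rule_format, of "Suc M"] by simp
    ultimately show "c k = 0" using k unfolding DM_family_Suc length_append
      using all_less_add[of _ _ "\<lambda>k. c k = 0"] by blast
  qed
qed

text \<open>The reverse passage, with the vanishing clause going from the whole to the pieces, as
  needed to apply independence.\<close>

lemma lin_combo_DM_family_merge:
  "\<exists>c. (\<forall>i j. lin_combo c (DM_family M Hs) i j = (\<Sum>m\<in>{1..M}. lin_combo (c' m) (Hs m) i j)) \<and>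
     ((\<forall>k<length (DM_family M Hs). c k = 0) \<longrightarrow> (\<forall>m\<in>{1..M}. \<forall>k<length (Hs m). c' m k = 0))"
proof (induction M)
  case 0
  then show ?case by (simp add: DM_family_0 lin_combo_def)
next
  case (Suc M)
  then obtain c where c: "\<And>i j. lin_combo c (DM_family M Hs) i j = (\<Sum>m\<in>{1..M}. lin_combo (c' m) (Hs m) i j)"
    "(\<forall>k<length (DM_family M Hs). c k = 0) \<Longrightarrow> (\<forall>m\<in>{1..M}. \<forall>k<length (Hs m). c' m k = 0)" by blast
  let ?c = "join_coeffs (length (DM_family M Hs)) c (c' (Suc M))"
  show ?case
  proof (rule exI[of _ ?c], rule conjI, intro allI, goal_cases)
    case (1 i j)
    then show ?case by (simp add: DM_family_Suc lin_combo_join_coeffs c)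
  next
    case 2
    show ?case
    proof
      assume "\<forall>k<length (DM_family (Suc M) Hs). ?c k = 0"
      then have "\<forall>k<length (DM_family M Hs). c k = 0" "\<forall>k<length (Hs (Suc M)). c' (Suc M) k = 0"
        unfolding DM_family_Suc length_append all_less_add by (simp_all add: join_coeffs_def)
      then show "\<forall>m\<in>{1..Suc M}. \<forall>k<length (Hs m). c' m k = 0"
        using c(2) by (auto simp: le_Suc_eq)
    qed
  qed
qed

text \<open>Turns independence into a statement about the operators X_m =
  \<open>lin_combo (c m) (Hs m)\<close> instead of coefficients. Once all X_m vanish, independence
  of each block kills the \<open>c m\<close>, the remaining relation involves \<open>zs\<close>
  alone, and independence of \<open>zs\<close> kills \<open>e\<close>.\<close>

lemma rlin_indep_DM_family_append:
  assumes H: "\<And>m. m \<in> {1..M} \<Longrightarrow> rlin_indep n (Hs m)" and Z: "rlin_indep n zs"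
  shows "rlin_indep n (DM_family M Hs @ zs) \<longleftrightarrow>
    (\<forall>c e. (\<forall>i<n. \<forall>j<n. (\<Sum>m\<in>{1..M}. lin_combo (c m) (Hs m) i j) + lin_combo e zs i j = 0)
      \<longrightarrow> (\<forall>m\<in>{1..M}. \<forall>i<n. \<forall>j<n. lin_combo (c m) (Hs m) i j = 0))"
proof
  have split_0: "\<forall>m\<in>{1..M}. \<forall>k<length (Hs m). c m k = 0"
    if "\<forall>m\<in>{1..M}. \<forall>i<n. \<forall>j<n. lin_combo (c m) (Hs m) i j = 0" for c
  proof
    fix m assume m: "m \<in> {1..M}"
    then show "\<forall>k<length (Hs m). c m k = 0"
      by (intro H[OF m, unfolded rlin_indep_lin_combo, THEN spec[of _ "c m"], THEN mp]) (rule that[THEN bspec])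
  qed
  {
    assume R: "\<forall>c e. (\<forall>i<n. \<forall>j<n. (\<Sum>m\<in>{1..M}. lin_combo (c m) (Hs m) i j) + lin_combo e zs i j = 0)
      \<longrightarrow> (\<forall>m\<in>{1..M}. \<forall>i<n. \<forall>j<n. lin_combo (c m) (Hs m) i j = 0)"
    show "rlin_indep n (DM_family M Hs @ zs)"
      unfolding rlin_indep_append
    proof (rule allI, rule allI, rule impI)
      fix c e assume *: "\<forall>i<n. \<forall>j<n. lin_combo c (DM_family M Hs) i j + lin_combo e zs i j = 0"
      obtain c' where c': "\<And>i j. lin_combo c (DM_family M Hs) i j = (\<Sum>m\<in>{1..M}. lin_combo (c' m) (Hs m) i j)"
        "(\<forall>m\<in>{1..M}. \<forall>k<length (Hs m). c' m k = 0) \<Longrightarrow> (\<forall>k<length (DM_family M Hs). c k = 0)"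
        by (rule exE[OF lin_combo_DM_family_split[of c M Hs]]) blast
      have "\<forall>i<n. \<forall>j<n. (\<Sum>m\<in>{1..M}. lin_combo (c' m) (Hs m) i j) + lin_combo e zs i j = 0"
        using * by (simp only: c'(1))
      then have z: "\<forall>m\<in>{1..M}. \<forall>i<n. \<forall>j<n. lin_combo (c' m) (Hs m) i j = 0"
        by (rule R[THEN spec[of _ c'], THEN spec[of _ e], THEN mp])
      have "lin_combo c (DM_family M Hs) i j = 0" if "i < n" "j < n" for i j
        unfolding c'(1) by (intro sum.neutral ballI) (rule z[rule_format, OF _ that])
      then have "\<forall>i<n. \<forall>j<n. lin_combo e zs i j = 0" using * by simp
      then have "\<forall>k<length zs. e k = 0" by (rule Z[unfolded rlin_indep_lin_combo, THEN spec[of _ e], THEN mp])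
      then show "(\<forall>k<length (DM_family M Hs). c k = 0) \<and> (\<forall>k<length zs. e k = 0)"
        using c'(2)[OF split_0[OF z]] by (rule conjI[rotated])
    qed
  }
  assume L: "rlin_indep n (DM_family M Hs @ zs)"
  show "\<forall>c e. (\<forall>i<n. \<forall>j<n. (\<Sum>m\<in>{1..M}. lin_combo (c m) (Hs m) i j) + lin_combo e zs i j = 0)
      \<longrightarrow> (\<forall>m\<in>{1..M}. \<forall>i<n. \<forall>j<n. lin_combo (c m) (Hs m) i j = 0)"
  proof (rule allI, rule allI, rule impI)
    fix c' e assume "\<forall>i<n. \<forall>j<n. (\<Sum>m\<in>{1..M}. lin_combo (c' m) (Hs m) i j) + lin_combo e zs i j = 0"
    moreover obtain c where c: "\<And>i j. lin_combo c (DM_family M Hs) i j = (\<Sum>m\<in>{1..M}. lin_combo (c' m) (Hs m) i j)"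
      "(\<forall>k<length (DM_family M Hs). c k = 0) \<Longrightarrow> (\<forall>m\<in>{1..M}. \<forall>k<length (Hs m). c' m k = 0)"
      by (rule exE[OF lin_combo_DM_family_merge[of M Hs c']]) blast
    ultimately have "\<forall>i<n. \<forall>j<n. lin_combo c (DM_family M Hs) i j + lin_combo e zs i j = 0" by (simp only: c(1))
    then have "\<forall>k<length (DM_family M Hs). c k = 0"
      by (rule L[unfolded rlin_indep_append, THEN spec[of _ c], THEN spec[of _ e], THEN mp, THEN conjunct1])
    note 0 = c(2)[OF this]
    show "\<forall>m\<in>{1..M}. \<forall>i<n. \<forall>j<n. lin_combo (c' m) (Hs m) i j = 0"
      by (intro ballI allI impI lin_combo_eq_0) (rule 0[rule_format])
  qed
qed

section \<open>Kronecker products and their index arithmetic\<close>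

lemma mult_add_less: "i < a \<Longrightarrow> k < b \<Longrightarrow> i * b + k < a * b" for i k a b :: nat
proof -
  assume "i < a" "k < b"
  then have "i * b + k < Suc i * b" by simp
  also have "\<dots> \<le> a * b" using \<open>i < a\<close> by (intro mult_right_mono) auto
  finally show ?thesis .
qed

lemma kron_entry:
  assumes "A \<in> carrier_mat a a" "B \<in> carrier_mat b b" "i < a" "j < a" "k < b" "l < b"
  shows "kron A B $$ (i * b + k, j * b + l) = A $$ (i,j) * B $$ (k,l)"
proof -
  have "i * b + k < a * b" "j * b + l < a * b"
    using assms by (auto intro: mult_add_less)
  then show ?thesis using assms by (simp add: kron_def)
qed

lemma kron_carrier: "A \<in> carrier_mat a a \<Longrightarrow> B \<in> carrier_mat b b \<Longrightarrow> kron A B \<in> carrier_mat (a * b) (a * b)"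
  by (simp add: kron_def)

text \<open>Division with remainder by \<open>b\<close> splits a composite index into its digits,
  the more significant one first. Identities on a tensor product are thereby checked block by
  block.\<close>

lemma all_less_mult: "(\<forall>I<a * b. P I) \<longleftrightarrow> (\<forall>i<a. \<forall>k<b. P (i * b + k :: nat))"
proof
  show "\<forall>I<a * b. P I \<Longrightarrow> \<forall>i<a. \<forall>k<b. P (i * b + k)" by (auto intro: mult_add_less)
  assume R: "\<forall>i<a. \<forall>k<b. P (i * b + k)"
  show "\<forall>I<a * b. P I"
  proof (intro allI impI)
    fix I assume I: "I < a * b"
    then have "I div b < a" "I mod b < b"
      by (cases "b = 0"; simp add: less_mult_imp_div_less)+
    then have "P (I div b * b + I mod b)" using R by blast
    then show "P I" by simp
  qed
qed

text \<open>The two inner loops of \<open>DN_family\<close>, with the nesting order kept: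
  \<open>Es\<close> outside, \<open>Fs\<close> inside.\<close>

definition kron_products :: "complex mat list \<Rightarrow> complex mat list \<Rightarrow> complex mat list" where
  "kron_products Es Fs = concat (map (\<lambda>E. map (kron E) Fs) Es)"

lemma length_kron_products: "length (kron_products Es Fs) = length Es * length Fs"
  by (induction Es) (simp_all add: kron_products_def)

lemma nth_kron_products: "p < length Es \<Longrightarrow> q < length Fs \<Longrightarrow> kron_products Es Fs ! (p * length Fs + q) = kron (Es ! p) (Fs ! q)"
proof (induction Es arbitrary: p)
  case (Cons E Es)
  show ?case
  proof (cases p)
    case (Suc p')
    then show ?thesis using Cons by (simp add: kron_products_def nth_append)
  qed (use Cons in \<open>simp add: kron_products_def nth_append\<close>)
qed simp

lemma lin_combo_kron_products: "lin_combo c (kron_products Es Fs) i j =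
  (\<Sum>p<length Es. \<Sum>q<length Fs. complex_of_real (c (p * length Fs + q)) * kron (Es ! p) (Fs ! q) $$ (i,j))"
proof -
  have sum_shift: "sum f {m..<m + n} = (\<Sum>q<n. f (m + q))" for f :: "nat \<Rightarrow> complex" and m n
    by (induction n) auto
  let ?g = "\<lambda>k. complex_of_real (c k) * (kron_products Es Fs ! k) $$ (i,j)"
  have "lin_combo c (kron_products Es Fs) i j = (\<Sum>p<length Es. sum ?g {p * length Fs..<p * length Fs + length Fs})"
    unfolding lin_combo_def length_kron_products by (rule sum.nat_group[symmetric])
  also have "\<dots> = (\<Sum>p<length Es. \<Sum>q<length Fs. ?g (p * length Fs + q))"
    by (simp only: sum_shift)
  finally show ?thesis by (simp add: nth_kron_products)
qed

text \<open>Collecting terms by \<open>Fs ! q\<close> shows the block (i,j) as a combination of the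
  F whose coefficients are entries of combinations of the E. These coefficients are complex,
  although \<open>c\<close> is real.\<close>

lemma lin_combo_products_entry:
  assumes "set Es \<subseteq> carrier_mat a a" "set Fs \<subseteq> carrier_mat b b" "i < a" "j < a" "k < b" "l < b"
  shows "lin_combo c (kron_products Es Fs) (i * b + k) (j * b + l) =
    (\<Sum>q<length Fs. (\<Sum>p<length Es. complex_of_real (c (p * length Fs + q)) * (Es ! p) $$ (i,j)) * (Fs ! q) $$ (k,l))"
proof -
  have e: "kron (Es ! p) (Fs ! q) $$ (i * b + k, j * b + l) = (Es ! p) $$ (i,j) * (Fs ! q) $$ (k,l)"
    if "p < length Es" "q < length Fs" for p q
    using assms that by (intro kron_entry) (auto simp: subset_iff)
  show ?thesis
    unfolding lin_combo_kron_products sum_distrib_right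
    by (subst sum.swap, intro sum.cong refl) (simp add: e)
qed

section \<open>Hermitian bases over the complex numbers\<close>

lemma herm_basis_carrier: "is_rbasis n (herm_space n) Fs \<Longrightarrow> set Fs \<subseteq> carrier_mat n n"
  by (auto simp: is_rbasis_def herm_space_def hermitian_op_def)

lemma herm_basis_nth: "is_rbasis n (herm_space n) Fs \<Longrightarrow> q < length Fs \<Longrightarrow> hermitian_op n (Fs ! q)"
  by (auto simp: is_rbasis_def herm_space_def subset_iff)

text \<open>Every matrix is \<open>H + \<i> K\<close> with \<open>H\<close>, \<open>K\<close> hermitian, so a real basis of the hermitian
  matrices is a complex basis of all matrices.\<close>

lemma herm_basis_complex_span:
  fixes X :: "nat \<Rightarrow> nat \<Rightarrow> complex"
  assumes "is_rbasis n (herm_space n) Fs"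
  shows "\<exists>y. \<forall>k<n. \<forall>l<n. X k l = (\<Sum>q<length Fs. y q * (Fs ! q) $$ (k,l))"
proof -
  define H where "H = mat n n (\<lambda>(k,l). (X k l + cnj (X l k)) / 2)"
  define K where "K = mat n n (\<lambda>(k,l). - (\<i> / 2) * (X k l - cnj (X l k)))"
  have "H \<in> herm_space n" "K \<in> herm_space n"
    by (simp_all add: H_def K_def herm_space_def hermitian_op_def complex_eq_iff diff_divide_distrib)
  then have "in_rspan n Fs H" "in_rspan n Fs K" using assms by (auto simp: is_rbasis_def)
  then obtain c e where c: "\<forall>k<n. \<forall>l<n. H $$ (k,l) = lin_combo c Fs k l" "\<forall>k<n. \<forall>l<n. K $$ (k,l) = lin_combo e Fs k l"
    unfolding in_rspan_lin_combo by (elim exE)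
  have "X k l = (\<Sum>q<length Fs. (complex_of_real (c q) + \<i> * complex_of_real (e q)) * (Fs ! q) $$ (k,l))"
    if "k < n" "l < n" for k l
  proof -
    have "X k l = H $$ (k,l) + \<i> * K $$ (k,l)" using that by (simp add: H_def K_def complex_eq_iff add_divide_distrib diff_divide_distrib)
    also have "\<dots> = lin_combo c Fs k l + \<i> * lin_combo e Fs k l" using c that by simp
    finally show ?thesis by (simp add: lin_combo_def sum.distrib sum_distrib_left distrib_right mult.assoc)
  qed
  then show ?thesis by (intro exI allI impI)
qed

text \<open>The adjoint of a relation among hermitian matrices is the relation with conjugated
  coefficients. Sum and difference of the two are real relations with coefficients
  \<open>Re (y q)\<close> and \<open>Im (y q)\<close>.\<close>

lemma herm_basis_complex_indep:
  assumes F: "is_rbasis n (herm_space n) Fs"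
    and z: "\<And>k l. k < n \<Longrightarrow> l < n \<Longrightarrow> (\<Sum>q<length Fs. y q * (Fs ! q) $$ (k,l)) = 0"
    and q: "q < length Fs"
  shows "y q = 0"
proof -
  have z': "(\<Sum>q<length Fs. cnj (y q) * (Fs ! q) $$ (k,l)) = 0" if "k < n" "l < n" for k l
  proof -
    have "(\<Sum>q<length Fs. cnj (y q) * (Fs ! q) $$ (k,l)) = cnj (\<Sum>q<length Fs. y q * (Fs ! q) $$ (l,k))"
      unfolding cnj_sum
      by (intro sum.cong refl) (simp add: hermitian_op_cnj[OF herm_basis_nth[OF F]] that)
    then show ?thesis using z that by simp
  qed
  have re: "lin_combo (\<lambda>q. Re (y q)) Fs k l = 0" if "k < n" "l < n" for k l
  proof -
    have "2 * lin_combo (\<lambda>q. Re (y q)) Fs k l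
      = (\<Sum>q<length Fs. y q * (Fs ! q) $$ (k,l)) + (\<Sum>q<length Fs. cnj (y q) * (Fs ! q) $$ (k,l))"
      unfolding lin_combo_def sum_distrib_left sum.distrib[symmetric] distrib_right[symmetric] complex_add_cnj
      by (simp add: mult.assoc)
    then show ?thesis using z z' that by simp
  qed
  have im: "lin_combo (\<lambda>q. Im (y q)) Fs k l = 0" if "k < n" "l < n" for k l
  proof -
    have "2 * \<i> * lin_combo (\<lambda>q. Im (y q)) Fs k l
      = (\<Sum>q<length Fs. y q * (Fs ! q) $$ (k,l)) - (\<Sum>q<length Fs. cnj (y q) * (Fs ! q) $$ (k,l))"
      unfolding lin_combo_def sum_distrib_left sum_subtractf[symmetric] left_diff_distrib[symmetric] complex_diff_cnj
      by (simp add: algebra_simps)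
    then show ?thesis using z z' that by simp
  qed
  have "\<forall>c. (\<forall>i<n. \<forall>j<n. lin_combo c Fs i j = 0) \<longrightarrow> (\<forall>k<length Fs. c k = 0)"
    using F by (simp add: is_rbasis_def rlin_indep_lin_combo)
  note this[THEN spec, THEN mp, THEN spec, THEN mp]
  from this[of "\<lambda>q. Re (y q)" q] this[of "\<lambda>q. Im (y q)" q]
  have "Re (y q) = 0" "Im (y q) = 0" using re im q by simp_all
  then show ?thesis by (simp add: complex_eq_iff)
qed

section \<open>Products of a traceless and a hermitian basis\<close>

lemma traceless_basis_carrier: "is_rbasis n (traceless_herm_space n) Es \<Longrightarrow> set Es \<subseteq> carrier_mat n n"
  by (auto simp: is_rbasis_def traceless_herm_space_def hermitian_op_def)

text \<open>Each block of a vanishing combination is a complex relation among the F. Complex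
  independence leaves, for every \<open>q\<close>, a real relation among the E.\<close>

lemma rlin_indep_kron_products:
  assumes E: "set Es \<subseteq> carrier_mat a a" "rlin_indep a Es" and F: "is_rbasis b (herm_space b) Fs"
  shows "rlin_indep (a * b) (kron_products Es Fs)"
  unfolding rlin_indep_lin_combo length_kron_products all_less_mult
proof (intro allI impI)
  fix c p q
  assume z: "\<forall>i<a. \<forall>k<b. \<forall>j<a. \<forall>l<b. lin_combo c (kron_products Es Fs) (i * b + k) (j * b + l) = 0"
    and pq: "p < length Es" "q < length Fs"
  have "(\<Sum>p<length Es. complex_of_real (c (p * length Fs + q)) * (Es ! p) $$ (i,j)) = 0"
    if "i < a" "j < a" for i j
    by (rule herm_basis_complex_indep[OF F _ pq(2)])
      (use z lin_combo_products_entry[OF E(1) herm_basis_carrier[OF F]] that in simp)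
  then show "c (p * length Fs + q) = 0"
    using E(2)[unfolded rlin_indep_def, rule_format, of "\<lambda>p. c (p * length Fs + q)" p] pq(1) by simp
qed

lemma ptrace_top_entry: "k < b \<Longrightarrow> l < b \<Longrightarrow> ptrace_top a b X $$ (k,l) = (\<Sum>i<a. X $$ (i * b + k, i * b + l))"
  by (simp add: ptrace_top_def)

text \<open>The partial trace of E (x) F is tr(E) F, and every E is traceless.\<close>

lemma ptrace_lin_combo_kron_products:
  assumes E: "is_rbasis a (traceless_herm_space a) Es" and F: "set Fs \<subseteq> carrier_mat b b"
    and kl: "k < b" "l < b"
  shows "(\<Sum>i<a. lin_combo c (kron_products Es Fs) (i * b + k) (i * b + l)) = 0"
proof -
  have tr: "(\<Sum>i<a. (Es ! p) $$ (i,i)) = 0" if "p < length Es" for p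
  proof -
    have "Es ! p \<in> traceless_herm_space a" using E that by (auto simp: is_rbasis_def subset_iff)
    moreover have "dim_row (Es ! p) = a"
      using traceless_basis_carrier[OF E] that nth_mem[OF that] by (meson carrier_matD(1) subsetD)
    ultimately show ?thesis by (simp add: traceless_herm_space_def mtrace_def)
  qed
  have "(\<Sum>i<a. lin_combo c (kron_products Es Fs) (i * b + k) (i * b + l)) = (\<Sum>i<a. \<Sum>q<length Fs.
      (\<Sum>p<length Es. complex_of_real (c (p * length Fs + q)) * (Es ! p) $$ (i,i)) * (Fs ! q) $$ (k,l))"
    by (intro sum.cong refl lin_combo_products_entry[OF traceless_basis_carrier[OF E] F]) (use kl in auto)
  also have "\<dots> = (\<Sum>q<length Fs. (\<Sum>p<length Es. complex_of_real (c (p * length Fs + q)) * (\<Sum>i<a. (Es ! p) $$ (i,i)))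
      * (Fs ! q) $$ (k,l))"
    unfolding sum_distrib_left sum_distrib_right
    by (subst sum.swap) (intro sum.cong refl sum.swap)
  also have "\<dots> = 0" by (simp add: tr)
  finally show ?thesis .
qed

text \<open>Every block Y_ij expands in the F with complex coefficients \<open>y i j q\<close>.
  Since this expansion is unique, hermiticity of \<open>Y\<close> makes the matrix \<open>y\<close>
  hermitian for each fixed \<open>q\<close>, and the vanishing partial trace makes it traceless; it
  is therefore a real combination of the E.\<close>

lemma in_rspan_kron_products:
  assumes E: "is_rbasis a (traceless_herm_space a) Es" and F: "is_rbasis b (herm_space b) Fs"
    and Y: "hermitian_op (a * b) Y"
    and tr: "\<And>k l. k < b \<Longrightarrow> l < b \<Longrightarrow> (\<Sum>i<a. Y $$ (i * b + k, i * b + l)) = 0"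
  shows "in_rspan (a * b) (kron_products Es Fs) Y"
proof -
  have "\<exists>y. \<forall>k<b. \<forall>l<b. Y $$ (i * b + k, j * b + l) = (\<Sum>q<length Fs. y q * (Fs ! q) $$ (k,l))" for i j
    by (rule herm_basis_complex_span[OF F])
  then obtain y where y: "\<And>i j k l. k < b \<Longrightarrow> l < b \<Longrightarrow>
      Y $$ (i * b + k, j * b + l) = (\<Sum>q<length Fs. y i j q * (Fs ! q) $$ (k,l))"
    by metis
  have bd: "i * b + k < a * b" if "i < a" "k < b" for i k
    using that by (rule mult_add_less)
  have herm: "y j i q = cnj (y i j q)" if ij: "i < a" "j < a" and q: "q < length Fs" for i j q
  proof -
    have "(\<Sum>q<length Fs. (y j i q - cnj (y i j q)) * (Fs ! q) $$ (k,l)) = 0" if kl: "k < b" "l < b" for k l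
    proof -
      have "(\<Sum>q<length Fs. cnj (y i j q) * (Fs ! q) $$ (k,l)) = cnj (\<Sum>q<length Fs. y i j q * (Fs ! q) $$ (l,k))"
        unfolding cnj_sum
        by (intro sum.cong refl) (simp add: hermitian_op_cnj[OF herm_basis_nth[OF F]] kl)
      also have "\<dots> = cnj (Y $$ (i * b + l, j * b + k))" using y kl by simp
      also have "\<dots> = Y $$ (j * b + k, i * b + l)"
        using hermitian_op_cnj[OF Y] bd ij kl by simp
      also have "\<dots> = (\<Sum>q<length Fs. y j i q * (Fs ! q) $$ (k,l))" using y kl by simp
      finally show ?thesis by (simp add: left_diff_distrib sum_subtractf)
    qed
    then have "y j i q - cnj (y i j q) = 0" by (rule herm_basis_complex_indep[OF F _ q])
    then show ?thesis by simp
  qed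
  have trace: "(\<Sum>i<a. y i i q) = 0" if q: "q < length Fs" for q
  proof (rule herm_basis_complex_indep[OF F _ q])
    fix k l assume kl: "k < b" "l < b"
    have "(\<Sum>q<length Fs. (\<Sum>i<a. y i i q) * (Fs ! q) $$ (k,l)) = (\<Sum>i<a. \<Sum>q<length Fs. y i i q * (Fs ! q) $$ (k,l))"
      unfolding sum_distrib_right by (rule sum.swap)
    also have "\<dots> = (\<Sum>i<a. Y $$ (i * b + k, i * b + l))" using y kl by simp
    finally show "(\<Sum>q<length Fs. (\<Sum>i<a. y i i q) * (Fs ! q) $$ (k,l)) = 0" using tr kl by simp
  qed
  have "\<exists>c. \<forall>i<a. \<forall>j<a. y i j q = lin_combo c Es i j" if q: "q < length Fs" for q
  proof -
    let ?Z = "mat a a (\<lambda>(i,j). y i j q)"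
    have "?Z \<in> traceless_herm_space a"
      using trace[OF q] by (auto simp: traceless_herm_space_def hermitian_op_def mtrace_def intro: herm q)
    then have "in_rspan a Es ?Z" using E by (simp add: is_rbasis_def)
    then show ?thesis unfolding in_rspan_lin_combo by auto
  qed
  then obtain c where c: "\<And>q i j. q < length Fs \<Longrightarrow> i < a \<Longrightarrow> j < a \<Longrightarrow> y i j q = lin_combo (c q) Es i j"
    by metis
  \<comment> \<open>Decodes the flat position p * \<open>length Fs\<close> + q of E_p (x)
    F_q.\<close>
  let ?c = "\<lambda>k. c (k mod length Fs) (k div length Fs)"
  have dm: "(p * length Fs + q) div length Fs = p" if "q < length Fs" for p q
    using that by (subst div_mult_self3) auto
  have "Y $$ (i * b + k, j * b + l) = lin_combo ?c (kron_products Es Fs) (i * b + k) (j * b + l)"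
    if "i < a" "j < a" "k < b" "l < b" for i j k l
    unfolding lin_combo_products_entry[OF traceless_basis_carrier[OF E] herm_basis_carrier[OF F] that] y[OF that(3,4)]
    by (intro sum.cong refl) (simp add: c that lin_combo_def dm)
  then show ?thesis
    unfolding in_rspan_lin_combo all_less_mult by blast
qed

section \<open>Comb constraints and the family D_(N)\<close>

text \<open>Counting levels from 0, where \<open>dimp d 0\<close> is 1, avoids truncated subtraction
  in the indices and lets inductions start at \<open>N = 0\<close>. Without positivity the condition
  is affine, so real combinations of towers are towers.\<close>

definition comb_tower :: "(nat \<Rightarrow> nat) \<Rightarrow> nat \<Rightarrow> real \<Rightarrow> (nat \<Rightarrow> complex mat) \<Rightarrow> bool" where
  "comb_tower d N r Rs \<longleftrightarrow> Rs 0 = complex_of_real r \<cdot>\<^sub>m 1\<^sub>m 1 \<and>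
     (\<forall>n\<le>N. Rs n \<in> carrier_mat (dimp d (2*n)) (dimp d (2*n))) \<and>
     (\<forall>n<N. ptrace_top (d (2*n+1)) (dimp d (2*n+1)) (Rs (Suc n)) = kron (1\<^sub>m (d (2*n))) (Rs n))"

text \<open>The affine constraints on a comb, with \<open>Tr_1 R^(1) = r I_0\<close> read as one more tower step down
  to the scalar \<open>r\<close>. Combs have \<open>r = 1\<close>, differences of combs have \<open>r = 0\<close>.\<close>

definition lin_comb :: "(nat \<Rightarrow> nat) \<Rightarrow> nat \<Rightarrow> real \<Rightarrow> complex mat \<Rightarrow> bool" where
  "lin_comb d N r R \<longleftrightarrow> (\<exists>Rs. Rs N = R \<and> comb_tower d N r Rs)"

lemma dimp_0: "dimp d 0 = 1" and dimp_Suc: "dimp d (Suc m) = d m * dimp d m"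
  by (simp_all add: dimp_def)

lemma kron_one_one: "kron (1\<^sub>m a) (1\<^sub>m 1) = 1\<^sub>m a"
  by (rule eq_matI) (auto simp: kron_def)

text \<open>The two kinds of witness sequence differ only at index 0, where \<open>det_comb\<close>
  imposes nothing and \<open>comb_tower\<close> demands a scalar.\<close>

lemma det_comb_iff_lin_comb:
  assumes "1 \<le> N"
  shows "det_comb d N R \<longleftrightarrow> positive_op (dimp d (2*N)) R \<and> lin_comb d N 1 R"
proof -
  have one: "complex_of_real 1 \<cdot>\<^sub>m 1\<^sub>m 1 = 1\<^sub>m 1" by (rule eq_matI) auto
  have d1: "dimp d (Suc 0) = d 0" by (simp add: dimp_def)
  have "lin_comb d N 1 R \<longleftrightarrow> (\<exists>Rs. Rs N = R \<and>
        (\<forall>n\<in>{1..N}. Rs n \<in> carrier_mat (dimp d (2*n)) (dimp d (2*n))) \<and>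
        (\<forall>n\<in>{2..N}. ptrace_top (d (2*n-1)) (dimp d (2*n-1)) (Rs n)
                       = kron (1\<^sub>m (d (2*n-2))) (Rs (n-1))) \<and>
        ptrace_top (d 1) (d 0) (Rs 1) = 1\<^sub>m (d 0))" (is "_ \<longleftrightarrow> (\<exists>Rs. ?P Rs)")
  proof
    assume "lin_comb d N 1 R"
    then obtain Rs where N: "Rs N = R" and Rs: "comb_tower d N 1 Rs" by (auto simp: lin_comb_def)
    have step: "ptrace_top (d (2*n+1)) (dimp d (2*n+1)) (Rs (Suc n)) = kron (1\<^sub>m (d (2*n))) (Rs n)" if "n < N" for n
      using Rs that by (simp add: comb_tower_def)
    have "ptrace_top (d (2*n-1)) (dimp d (2*n-1)) (Rs n) = kron (1\<^sub>m (d (2*n-2))) (Rs (n-1))" if "n \<in> {2..N}" for n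
    proof -
      have "n = Suc (n - 1)" "n - 1 < N" using that by auto
      then obtain m where "n = Suc m" "m < N" by blast
      then show ?thesis using step[of m] by simp
    qed
    moreover have "ptrace_top (d 1) (d 0) (Rs 1) = 1\<^sub>m (d 0)"
      using step[of 0] assms Rs kron_one_one unfolding comb_tower_def one by (simp add: d1)
    ultimately have "?P Rs" using N Rs by (simp add: comb_tower_def)
    then show "\<exists>Rs. ?P Rs" by blast
  next
    assume "\<exists>Rs. ?P Rs"
    then obtain Rs where N: "Rs N = R"
      and c: "\<And>n. n \<in> {1..N} \<Longrightarrow> Rs n \<in> carrier_mat (dimp d (2*n)) (dimp d (2*n))"
      and s: "\<And>n. n \<in> {2..N} \<Longrightarrow> ptrace_top (d (2*n-1)) (dimp d (2*n-1)) (Rs n) = kron (1\<^sub>m (d (2*n-2))) (Rs (n-1))"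
      and b: "ptrace_top (d 1) (d 0) (Rs 1) = 1\<^sub>m (d 0)" by blast
    \<comment> \<open>Overwriting index 0 does not touch the comb itself, as \<open>N\<close> is at
      least 1.\<close>
    let ?Q = "Rs(0 := 1\<^sub>m 1)"
    have "comb_tower d N 1 ?Q"
      unfolding comb_tower_def one
    proof (intro conjI allI impI)
      fix n assume "n \<le> N"
      then show "?Q n \<in> carrier_mat (dimp d (2*n)) (dimp d (2*n))"
        using c[of n] by (cases n) (auto simp: dimp_0)
    next
      fix n assume "n < N"
      then show "ptrace_top (d (2*n+1)) (dimp d (2*n+1)) (?Q (Suc n)) = kron (1\<^sub>m (d (2*n))) (?Q n)"
        using b s[of "Suc n"] by (cases n) (auto simp: d1 kron_one_one[unfolded One_nat_def])
    qed simp
    moreover have "?Q N = R" using N assms by simp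
    ultimately show "lin_comb d N 1 R" unfolding lin_comb_def by blast
  qed
  then show ?thesis by (simp add: det_comb_def)
qed

lemma lin_comb_0: "lin_comb d 0 r R \<longleftrightarrow> R = complex_of_real r \<cdot>\<^sub>m 1\<^sub>m 1"
  by (auto simp: lin_comb_def comb_tower_def dimp_0 intro: exI[of _ "\<lambda>_. R"])

lemma lin_comb_Suc:
  "lin_comb d (Suc N) r R \<longleftrightarrow> R \<in> carrier_mat (dimp d (2*N+2)) (dimp d (2*N+2)) \<and>
     (\<exists>R'. lin_comb d N r R' \<and> ptrace_top (d (2*N+1)) (dimp d (2*N+1)) R = kron (1\<^sub>m (d (2*N))) R')"
proof
  assume "lin_comb d (Suc N) r R"
  then obtain Rs where "Rs (Suc N) = R" "comb_tower d (Suc N) r Rs" by (auto simp: lin_comb_def)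
  moreover from this have "lin_comb d N r (Rs N)" unfolding lin_comb_def
    by (intro exI[of _ Rs]) (auto simp: comb_tower_def)
  ultimately show "R \<in> carrier_mat (dimp d (2*N+2)) (dimp d (2*N+2)) \<and>
     (\<exists>R'. lin_comb d N r R' \<and> ptrace_top (d (2*N+1)) (dimp d (2*N+1)) R = kron (1\<^sub>m (d (2*N))) R')"
    by (intro conjI exI[of _ "Rs N"]) (auto simp: comb_tower_def)
next
  assume A: "R \<in> carrier_mat (dimp d (2*N+2)) (dimp d (2*N+2)) \<and>
     (\<exists>R'. lin_comb d N r R' \<and> ptrace_top (d (2*N+1)) (dimp d (2*N+1)) R = kron (1\<^sub>m (d (2*N))) R')"
  then obtain Rs where Rs: "comb_tower d N r Rs"
    "ptrace_top (d (2*N+1)) (dimp d (2*N+1)) R = kron (1\<^sub>m (d (2*N))) (Rs N)" by (auto simp: lin_comb_def)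
  have "comb_tower d (Suc N) r (Rs(Suc N := R))"
    using A Rs by (auto simp: comb_tower_def le_Suc_eq less_Suc_eq)
  then show "lin_comb d (Suc N) r R" unfolding lin_comb_def by (intro exI[of _ "Rs(Suc N := R)"]) simp
qed

lemma lin_comb_carrier: "lin_comb d N r R \<Longrightarrow> R \<in> carrier_mat (dimp d (2*N)) (dimp d (2*N))"
  by (auto simp: lin_comb_def comb_tower_def)

lemma ptrace_top_combo:
  assumes "A \<in> carrier_mat (a * b) (a * b)" "B \<in> carrier_mat (a * b) (a * b)"
  shows "ptrace_top a b (x \<cdot>\<^sub>m A + y \<cdot>\<^sub>m B) = x \<cdot>\<^sub>m ptrace_top a b A + y \<cdot>\<^sub>m ptrace_top a b B"
  using assms mult_add_less
  by (intro eq_matI) (auto simp: ptrace_top_def sum.distrib sum_distrib_left)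

lemma kron_combo:
  assumes "C \<in> carrier_mat a a" "A \<in> carrier_mat b b" "B \<in> carrier_mat b b"
  shows "kron C (x \<cdot>\<^sub>m A + y \<cdot>\<^sub>m B) = x \<cdot>\<^sub>m kron C A + y \<cdot>\<^sub>m kron C B"
proof (rule eq_matI)
  fix i j assume "i < dim_row (x \<cdot>\<^sub>m kron C A + y \<cdot>\<^sub>m kron C B)" "j < dim_col (x \<cdot>\<^sub>m kron C A + y \<cdot>\<^sub>m kron C B)"
  then have ij: "i < a * b" "j < a * b" using assms by (auto simp: kron_def)
  then have "b \<noteq> 0" by (intro notI) simp
  then show "kron C (x \<cdot>\<^sub>m A + y \<cdot>\<^sub>m B) $$ (i,j) = (x \<cdot>\<^sub>m kron C A + y \<cdot>\<^sub>m kron C B) $$ (i,j)"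
    using assms ij by (simp add: kron_def algebra_simps)
qed (use assms in \<open>auto simp: kron_def\<close>)

text \<open>Partial trace and tensoring with an identity are linear, so towers combine level by
  level. Two cases matter later: the difference of two combs has r = 0, and adding a multiple of an
  operator with r = 0 to a comb keeps r = 1.\<close>

lemma lin_comb_combo:
  assumes "lin_comb d N r A" "lin_comb d N s B"
  shows "lin_comb d N (x * r + y * s) (complex_of_real x \<cdot>\<^sub>m A + complex_of_real y \<cdot>\<^sub>m B)"
  using assms
proof (induction N arbitrary: A B)
  case 0
  then show ?case by (auto simp: lin_comb_0 intro!: eq_matI)
next
  case (Suc N)
  let ?a = "d (2*N+1)" and ?b = "dimp d (2*N+1)"
  have ab: "dimp d (2*N+2) = ?a * ?b" by (simp add: dimp_Suc)
  obtain A' B' where A': "lin_comb d N r A'" "ptrace_top ?a ?b A = kron (1\<^sub>m (d (2*N))) A'"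
    and B': "lin_comb d N s B'" "ptrace_top ?a ?b B = kron (1\<^sub>m (d (2*N))) B'"
    and c: "A \<in> carrier_mat (?a * ?b) (?a * ?b)" "B \<in> carrier_mat (?a * ?b) (?a * ?b)"
    using Suc.prems unfolding lin_comb_Suc ab by blast
  show ?case
    unfolding lin_comb_Suc ab ptrace_top_combo[OF c] A' B'
    using Suc.IH[OF A'(1) B'(1)] c
      kron_combo[OF one_carrier_mat lin_comb_carrier[OF A'(1)] lin_comb_carrier[OF B'(1)]] by auto
qed

section \<open>Recursive form of \<open>DN_family\<close>\<close>

lemma kron_one_assoc:
  assumes "X \<in> carrier_mat m m"
  shows "kron (1\<^sub>m p) (kron (1\<^sub>m q) X) = kron (1\<^sub>m (p * q)) X"
proof (rule eq_matI)
  fix i j assume "i < dim_row (kron (1\<^sub>m (p * q)) X)" "j < dim_col (kron (1\<^sub>m (p * q)) X)"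
  then have ij: "i < p * q * m" "j < p * q * m" using assms by (auto simp: kron_def)
  then have "q \<noteq> 0" "m \<noteq> 0" by (intro notI; simp)+
  then have pos: "0 < q" "0 < m" by simp_all
  have lt: "k div (q * m) < p" "k div m < p * q" "k div m mod q < q" "k mod (q * m) < q * m" "k mod m < m"
    if "k < p * q * m" for k
    using that pos by (auto simp: less_mult_imp_div_less mult.assoc)
  have sp: "k mod (q * m) div m = k div m mod q" "k mod (q * m) mod m = k mod m" "k div (q * m) = k div m div q" for k
    using pos by (auto simp: mult.commute[of q m] mod_mult2_eq div_mult2_eq)
  \<comment> \<open>An entry of the identity of size p q is 1 exactly when both digits of the two
    indices agree.\<close>
  have eq: "(i div m = j div m) \<longleftrightarrow> i div m div q = j div m div q \<and> i div m mod q = j div m mod q"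
    by (metis div_mult_mod_eq)
  show "kron (1\<^sub>m p) (kron (1\<^sub>m q) X) $$ (i,j) = kron (1\<^sub>m (p * q)) X $$ (i,j)"
    using assms ij lt[OF ij(1)] lt[OF ij(2)] eq by (simp add: kron_def sp mult.assoc)
qed (use assms in \<open>auto simp: kron_def\<close>)

lemma kron_one_1: "X \<in> carrier_mat m m \<Longrightarrow> kron (1\<^sub>m 1) X = X"
  by (rule eq_matI) (auto simp: kron_def)

lemma DN_family_0: "DN_family d 0 Es Fs = []"
  by (simp add: DN_family_def)

lemma DN_family_carrier:
  assumes "\<And>n. n < N \<Longrightarrow> set (Es (2*n+1)) \<subseteq> carrier_mat (d (2*n+1)) (d (2*n+1))"
    and "\<And>n. n < N \<Longrightarrow> set (Fs (2*n)) \<subseteq> carrier_mat (dimp d (2*n+1)) (dimp d (2*n+1))"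
  shows "set (DN_family d N Es Fs) \<subseteq> carrier_mat (dimp d (2*N)) (dimp d (2*N))"
proof
  fix X assume "X \<in> set (DN_family d N Es Fs)"
  then obtain n E F where n: "1 \<le> n" "n \<le> N" and E: "E \<in> set (Es (2*n-1))" and F: "F \<in> set (Fs (2*n-2))"
    and X: "X = kron (1\<^sub>m (\<Prod>k\<in>{2*n..<2*N}. d k)) (kron E F)"
    by (auto simp: DN_family_def)
  \<comment> \<open>With n = \<open>Suc m\<close> the indices \<open>2*n-1\<close> and
    \<open>2*n-2\<close> become \<open>2*m+1\<close> and \<open>2*m\<close>.\<close>
  have "n = Suc (n - 1)" "n - 1 < N" using n by auto
  then obtain m where m: "n = Suc m" "m < N" by blast
  have "E \<in> carrier_mat (d (2*m+1)) (d (2*m+1))" "F \<in> carrier_mat (dimp d (2*m+1)) (dimp d (2*m+1))"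
    using E F m assms[of m] by auto
  then have "X \<in> carrier_mat ((\<Prod>k\<in>{2*n..<2*N}. d k) * (d (2*m+1) * dimp d (2*m+1)))
     ((\<Prod>k\<in>{2*n..<2*N}. d k) * (d (2*m+1) * dimp d (2*m+1)))"
    unfolding X by (intro kron_carrier) auto
  moreover have "(\<Prod>k\<in>{2*n..<2*N}. d k) * (d (2*m+1) * dimp d (2*m+1)) = dimp d (2*N)"
  proof -
    have "d (2*m+1) * dimp d (2*m+1) = dimp d (2*n)" using m by (simp add: dimp_Suc)
    moreover have "dimp d (2*n) * (\<Prod>k\<in>{2*n..<2*N}. d k) = dimp d (2*N)"
      unfolding dimp_def lessThan_atLeast0 using n by (intro prod.atLeastLessThan_concat) auto
    ultimately show ?thesis by (simp add: mult.commute)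
  qed
  ultimately show "X \<in> carrier_mat (dimp d (2*N)) (dimp d (2*N))" by simp
qed

text \<open>Raising \<open>N\<close> by one lengthens every old identity prefix by the factors of
  dimension \<open>d (2*N)\<close> and \<open>d (2*N+1)\<close>; \<open>kron_one_assoc\<close> pulls
  them out in front. The new products, at n = \<open>Suc N\<close>, have an empty prefix.\<close>

lemma DN_family_Suc:
  assumes E: "\<And>n. n \<le> N \<Longrightarrow> set (Es (2*n+1)) \<subseteq> carrier_mat (d (2*n+1)) (d (2*n+1))"
    and F: "\<And>n. n \<le> N \<Longrightarrow> set (Fs (2*n)) \<subseteq> carrier_mat (dimp d (2*n+1)) (dimp d (2*n+1))"
  shows "DN_family d (Suc N) Es Fs =
    map (kron (1\<^sub>m (d (2*N+1) * d (2*N)))) (DN_family d N Es Fs) @ kron_products (Es (2*N+1)) (Fs (2*N))"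
proof -
  have carr: "A \<in> carrier_mat (d (2*n-1)) (d (2*n-1))" "B \<in> carrier_mat (dimp d (2*n-1)) (dimp d (2*n-1))"
    if "A \<in> set (Es (2*n-1))" "B \<in> set (Fs (2*n-2))" "1 \<le> n" "n \<le> Suc N" for n A B
  proof -
    have "n = Suc (n - 1)" "n - 1 \<le> N" using that by auto
    then obtain m where m: "n = Suc m" "m \<le> N" by blast
    then show "A \<in> carrier_mat (d (2*n-1)) (d (2*n-1))" "B \<in> carrier_mat (dimp d (2*n-1)) (dimp d (2*n-1))"
      using that E[of m] F[of m] by auto
  qed
  have 1: "kron (1\<^sub>m (\<Prod>k\<in>{2*n..<2*Suc N}. d k)) (kron A B) =
      kron (1\<^sub>m (d (2*N+1) * d (2*N))) (kron (1\<^sub>m (\<Prod>k\<in>{2*n..<2*N}. d k)) (kron A B))"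
    if "A \<in> set (Es (2*n-1))" "B \<in> set (Fs (2*n-2))" "1 \<le> n" "n \<le> N" for n A B
  proof -
    have "kron A B \<in> carrier_mat (d (2*n-1) * dimp d (2*n-1)) (d (2*n-1) * dimp d (2*n-1))"
      using carr[OF that(1-3)] that(4) by (intro kron_carrier) auto
    from kron_one_assoc[OF this] show ?thesis using that by (simp add: mult_ac)
  qed
  have 2: "kron (1\<^sub>m 1) (kron A B) = kron A B" if "A \<in> set (Es (2*N+1))" "B \<in> set (Fs (2*N))" for A B
    using that carr[of A "Suc N" B] by (intro kron_one_1[OF kron_carrier]) auto
  have a: "DN_family d (Suc N) Es Fs = concat (map (\<lambda>n.
      concat (map (\<lambda>E. map (\<lambda>F. kron (1\<^sub>m (\<Prod>k\<in>{2*n..<2*Suc N}. d k)) (kron E F)) (Fs (2*n-2)))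
        (Es (2*n-1)))) [1..<Suc N]) @
      concat (map (\<lambda>E. map (\<lambda>F. kron (1\<^sub>m 1) (kron E F)) (Fs (2*N))) (Es (2*N+1)))"
    by (simp add: DN_family_def)
  have b: "concat (map (\<lambda>n.
      concat (map (\<lambda>E. map (\<lambda>F. kron (1\<^sub>m (\<Prod>k\<in>{2*n..<2*Suc N}. d k)) (kron E F)) (Fs (2*n-2)))
        (Es (2*n-1)))) [1..<Suc N]) = map (kron (1\<^sub>m (d (2*N+1) * d (2*N)))) (DN_family d N Es Fs)"
    unfolding DN_family_def map_concat map_map comp_def
    by (intro arg_cong[where f = concat] map_cong refl 1) auto
  have c: "concat (map (\<lambda>E. map (\<lambda>F. kron (1\<^sub>m 1) (kron E F)) (Fs (2*N))) (Es (2*N+1)))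
      = kron_products (Es (2*N+1)) (Fs (2*N))"
    unfolding kron_products_def by (intro arg_cong[where f = concat] map_cong refl 2)
  show ?thesis unfolding a b c ..
qed

lemma kron_one_entry:
  assumes "X \<in> carrier_mat m m" "i < p" "j < p" "k < m" "l < m"
  shows "kron (1\<^sub>m p) X $$ (i * m + k, j * m + l) = (if i = j then X $$ (k,l) else 0)"
  using kron_entry[OF one_carrier_mat assms] assms by simp

lemma hermitian_kron_one:
  assumes "hermitian_op m X" shows "hermitian_op (p * m) (kron (1\<^sub>m p) X)"
proof -
  have c: "X \<in> carrier_mat m m" using assms by (simp add: hermitian_op_def)
  show ?thesis
    unfolding hermitian_op_def all_less_mult using kron_carrier[OF one_carrier_mat c]
    by (simp add: kron_one_entry[OF c] hermitian_op_cnj[OF assms])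
qed

lemma lin_combo_map_kron_one:
  assumes "set Bs \<subseteq> carrier_mat m m" "i < p" "j < p" "k < m" "l < m"
  shows "lin_combo c (map (kron (1\<^sub>m p)) Bs) (i * m + k) (j * m + l) = (if i = j then lin_combo c Bs k l else 0)"
proof -
  have "kron (1\<^sub>m p) (Bs ! q) $$ (i * m + k, j * m + l) = (if i = j then (Bs ! q) $$ (k,l) else 0)"
    if "q < length Bs" for q
    using assms that by (intro kron_one_entry) (auto simp: subset_iff)
  then show ?thesis by (simp add: lin_combo_def)
qed

text \<open>All three claims rest on how the partial trace over the top factor acts on the recursion
  \<open>L @ K\<close>: it kills \<open>K\<close>, and on \<open>L\<close> it is \<open>a\<close>
  times the identity tensored with a combination of the family for \<open>N\<close>. So it reads off
  the \<open>L\<close> part, and what remains concerns \<open>K\<close> alone.\<close>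

lemma DN_family_indep_and_span:
  assumes "\<And>k. k < 2*N \<Longrightarrow> 0 < d k"
    and "\<And>n. n < N \<Longrightarrow> is_rbasis (d (2*n+1)) (traceless_herm_space (d (2*n+1))) (Es (2*n+1))"
    and "\<And>n. n < N \<Longrightarrow> is_rbasis (dimp d (2*n+1)) (herm_space (dimp d (2*n+1))) (Fs (2*n))"
  shows "rlin_indep (dimp d (2*N)) (DN_family d N Es Fs) \<and>
    (\<forall>X \<in> carrier_mat (dimp d (2*N)) (dimp d (2*N)).
       in_rspan (dimp d (2*N)) (DN_family d N Es Fs) X \<longrightarrow> lin_comb d N 0 X) \<and>
    (\<forall>X. hermitian_op (dimp d (2*N)) X \<longrightarrow> lin_comb d N 0 X \<longrightarrow>
       in_rspan (dimp d (2*N)) (DN_family d N Es Fs) X)"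
  using assms
proof (induction N)
  case 0
  show ?case
    by (auto simp: DN_family_0 rlin_indep_def in_rspan_def lin_comb_0 dimp_0 intro!: eq_matI)
next
  case (Suc N)
  define a b e m where "a = d (2*N+1)" and "b = dimp d (2*N+1)" and "e = d (2*N)" and "m = dimp d (2*N)"
  define B where "B = DN_family d N Es Fs"
  define K where "K = kron_products (Es (2*N+1)) (Fs (2*N))"
  define L where "L = map (kron (1\<^sub>m (a * e))) B"
  have pos: "0 < a" "0 < e" using Suc.prems(1)[of "2*N+1"] Suc.prems(1)[of "2*N"] by (auto simp: a_def e_def)
  have bem: "b = e * m" by (simp add: b_def e_def m_def dimp_Suc)
  have D: "dimp d (2 * Suc N) = a * b" by (simp add: a_def b_def dimp_Suc)
  have E: "is_rbasis a (traceless_herm_space a) (Es (2*N+1))" using Suc.prems(2)[of N] by (simp add: a_def)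
  have F: "is_rbasis b (herm_space b) (Fs (2*N))" using Suc.prems(3)[of N] by (simp add: b_def)
  have Ec: "set (Es (2*n+1)) \<subseteq> carrier_mat (d (2*n+1)) (d (2*n+1))" if "n \<le> N" for n
    using that by (intro traceless_basis_carrier Suc.prems(2)) simp
  have Fc: "set (Fs (2*n)) \<subseteq> carrier_mat (dimp d (2*n+1)) (dimp d (2*n+1))" if "n \<le> N" for n
    using that by (intro herm_basis_carrier Suc.prems(3)) simp
  have DN: "DN_family d (Suc N) Es Fs = L @ K"
    unfolding L_def K_def B_def a_def e_def using Ec Fc by (rule DN_family_Suc)
  have Bc: "set B \<subseteq> carrier_mat m m"
    unfolding B_def m_def by (intro DN_family_carrier Ec Fc) auto
  have IH: "rlin_indep m B" "\<And>X. X \<in> carrier_mat m m \<Longrightarrow> in_rspan m B X \<Longrightarrow> lin_comb d N 0 X"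
    "\<And>X. hermitian_op m X \<Longrightarrow> lin_comb d N 0 X \<Longrightarrow> in_rspan m B X"
    using Suc.IH Suc.prems unfolding m_def B_def by auto
  have K_indep: "rlin_indep (a * b) K"
    unfolding K_def using E traceless_basis_carrier[OF E] F by (intro rlin_indep_kron_products) (auto simp: is_rbasis_def)
  have K_tr: "(\<Sum>i<a. lin_combo c K (i * b + u) (i * b + v)) = 0" if "u < b" "v < b" for c u v
    unfolding K_def using E herm_basis_carrier[OF F] that by (rule ptrace_lin_combo_kron_products)
  \<comment> \<open>For \<open>L\<close> the two top digits act as one digit of the identity of size
    a e.\<close>
  have idx: "i * b + (i' * m + k) = (i * e + i') * m + k" for i i' k by (simp add: bem algebra_simps)
  \<comment> \<open>The traced digit agrees on both sides, so only i' = j' decides whether the entry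
    survives, and all \<open>a\<close> summands are equal.\<close>
  have L_tr: "(\<Sum>i<a. lin_combo c L (i * b + (i' * m + k)) (i * b + (j' * m + l))) = of_nat a * (if i' = j' then lin_combo c B k l else 0)"
    if "i' < e" "j' < e" "k < m" "l < m" for c i' j' k l
  proof -
    have "lin_combo c L (i * b + (i' * m + k)) (i * b + (j' * m + l)) = (if i' = j' then lin_combo c B k l else 0)" if "i < a" for i
      unfolding idx L_def using that \<open>i' < e\<close> \<open>j' < e\<close> \<open>k < m\<close> \<open>l < m\<close>
      by (subst lin_combo_map_kron_one[OF Bc]) (auto intro: mult_add_less)
    then show ?thesis by simp
  qed
  have LK_tr: "(\<Sum>i<a. lin_combo c L (i * b + (i' * m + k)) (i * b + (j' * m + l)) + lin_combo c' K (i * b + (i' * m + k)) (i * b + (j' * m + l)))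
      = of_nat a * (if i' = j' then lin_combo c B k l else 0)"
    if "i' < e" "j' < e" "k < m" "l < m" for c c' i' j' k l
    unfolding sum.distrib L_tr[OF that] using K_tr[of "i' * m + k" "j' * m + l" c'] that
    by (simp add: bem mult_add_less)
  have lt: "i * b + (i' * m + k) < a * b" if "i < a" "i' < e" "k < m" for i i' k
    using that by (auto simp: bem intro!: mult_add_less)
  have "rlin_indep (a * b) (L @ K)"
    unfolding rlin_indep_append
  proof (rule allI, rule allI, rule impI)
    fix c c' assume z: "\<forall>i<a * b. \<forall>j<a * b. lin_combo c L i j + lin_combo c' K i j = 0"
    \<comment> \<open>Read off the diagonal block i' = j' = 0, which exists since \<open>e\<close>
      is positive, and divide by \<open>a\<close>.\<close>
    have "lin_combo c B k l = 0" if "k < m" "l < m" for k l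
      using LK_tr[OF pos(2) pos(2) that, of c c'] z lt[OF _ pos(2)] that pos(1) by simp
    then have c0: "\<forall>k<length B. c k = 0"
      using IH(1)[unfolded rlin_indep_lin_combo, THEN spec[of _ c]] by simp
    then have "lin_combo c L i j = 0" for i j by (intro lin_combo_eq_0) (simp add: L_def)
    then have "\<forall>k<length K. c' k = 0"
      using K_indep[unfolded rlin_indep_lin_combo, THEN spec[of _ c']] z by simp
    with c0 show "(\<forall>k<length L. c k = 0) \<and> (\<forall>k<length K. c' k = 0)" by (simp add: L_def)
  qed
  moreover have "lin_comb d (Suc N) 0 X" if X: "X \<in> carrier_mat (a * b) (a * b)" "in_rspan (a * b) (L @ K) X" for X
  proof -
    obtain c where c: "\<And>i j. i < a * b \<Longrightarrow> j < a * b \<Longrightarrow> X $$ (i,j) = lin_combo c (L @ K) i j"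
      using X(2) unfolding in_rspan_lin_combo by blast
    \<comment> \<open>The factor \<open>a\<close> is the trace of the identity on the top
      space.\<close>
    let ?R = "mat m m (\<lambda>(k,l). of_nat a * lin_combo c B k l)"
    have "in_rspan m B ?R"
      unfolding in_rspan_lin_combo using lin_combo_combo[of "real a" c 0 c B] by (intro exI[of _ "\<lambda>k. real a * c k + 0 * c k"]) simp
    then have R: "lin_comb d N 0 ?R" by (intro IH(2)) auto
    have "ptrace_top a b X $$ (i' * m + k, j' * m + l) = kron (1\<^sub>m e) ?R $$ (i' * m + k, j' * m + l)"
      if "i' < e" "j' < e" "k < m" "l < m" for i' j' k l
    proof -
      have "ptrace_top a b X $$ (i' * m + k, j' * m + l)
        = (\<Sum>i<a. lin_combo c (L @ K) (i * b + (i' * m + k)) (i * b + (j' * m + l)))"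
        using that by (simp add: ptrace_top_entry bem mult_add_less) (intro sum.cong refl c[unfolded bem] lt[unfolded bem]; simp)
      also have "\<dots> = of_nat a * (if i' = j' then lin_combo c B k l else 0)"
        unfolding lin_combo_append by (rule LK_tr[OF that])
      also have "\<dots> = kron (1\<^sub>m e) ?R $$ (i' * m + k, j' * m + l)"
        using that by (subst kron_one_entry[of _ m]) auto
      finally show ?thesis .
    qed
    then have "\<forall>u<e * m. \<forall>v<e * m. ptrace_top a b X $$ (u,v) = kron (1\<^sub>m e) ?R $$ (u,v)"
      unfolding all_less_mult by blast
    then have "ptrace_top a b X = kron (1\<^sub>m e) ?R"
      by (intro eq_matI) (auto simp: ptrace_top_def kron_def bem)
    then show ?thesis
      unfolding lin_comb_Suc using R X(1) D by (auto simp: a_def b_def e_def)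
  qed
  moreover have "in_rspan (a * b) (L @ K) X" if X: "hermitian_op (a * b) X" "lin_comb d (Suc N) 0 X" for X
  proof -
    obtain R where R: "lin_comb d N 0 R" "ptrace_top a b X = kron (1\<^sub>m e) R"
      using X(2) unfolding lin_comb_Suc a_def b_def e_def by blast
    have Rc: "R \<in> carrier_mat m m" using lin_comb_carrier[OF R(1)] by (simp add: m_def)
    have Xc: "X \<in> carrier_mat (a * b) (a * b)" using X(1) by (simp add: hermitian_op_def)
    have tr: "(\<Sum>i<a. X $$ (i * b + (i' * m + k), i * b + (j' * m + l))) = (if i' = j' then R $$ (k,l) else 0)"
      if "i' < e" "j' < e" "k < m" "l < m" for i' j' k l
      using ptrace_top_entry[of "i' * m + k" b "j' * m + l" a X] kron_one_entry[OF Rc that(1,2,3,4)] that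
      unfolding R(2) by (simp add: bem mult_add_less)
    \<comment> \<open>\<open>lin_comb\<close> says nothing about hermiticity of the lower level;
      \<open>R\<close> inherits it from \<open>X\<close>, being block 0 of the partial trace. The
      induction hypothesis asks for it.\<close>
    have Rh: "hermitian_op m R"
      unfolding hermitian_op_def
    proof (intro conjI allI impI Rc)
      fix k l assume kl: "k < m" "l < m"
      have "cnj (R $$ (k,l)) = (\<Sum>i<a. cnj (X $$ (i * b + (0 * m + k), i * b + (0 * m + l))))"
        using tr[OF pos(2) pos(2) kl] by (simp del: cnj_sum add: cnj_sum[symmetric])
      also have "\<dots> = (\<Sum>i<a. X $$ (i * b + (0 * m + l), i * b + (0 * m + k)))"
        by (intro sum.cong refl hermitian_op_cnj[OF X(1)] lt pos kl) auto
      also have "\<dots> = R $$ (l,k)" using tr[OF pos(2) pos(2) kl(2,1)] by simp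
      finally show "R $$ (l,k) = cnj (R $$ (k,l))" by simp
    qed
    obtain c where c: "\<And>k l. k < m \<Longrightarrow> l < m \<Longrightarrow> R $$ (k,l) = lin_combo c B k l"
      using IH(3)[OF Rh R(1)] unfolding in_rspan_lin_combo by blast
    \<comment> \<open>Dividing by \<open>a\<close> makes the \<open>L\<close> part have the same
      partial trace as \<open>X\<close>. The term \<open>0 * c k\<close> only matches the shape of
      \<open>lin_combo_combo\<close>.\<close>
    define c' where "c' = (\<lambda>k. (1 / real a) * c k + 0 * c k)"
    have c'B: "lin_combo c' B k l = complex_of_real (1 / real a) * lin_combo c B k l" for k l
      unfolding c'_def lin_combo_combo by simp
    let ?P = "kron (1\<^sub>m (a * e)) R"
    have Dm: "a * e * m = a * b" by (simp add: bem)
    have Pc: "?P \<in> carrier_mat (a * b) (a * b)" using kron_carrier[OF one_carrier_mat Rc, of "a * e"] by (simp add: Dm)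
    define Y where "Y = complex_of_real 1 \<cdot>\<^sub>m X + complex_of_real (- 1 / real a) \<cdot>\<^sub>m ?P"
    have "\<forall>u<a * e * m. \<forall>v<a * e * m. complex_of_real (1 / real a) * ?P $$ (u,v) = lin_combo c' L u v"
      unfolding all_less_mult[of "a * e" m] L_def
      by (simp add: lin_combo_map_kron_one[OF Bc] kron_one_entry[OF Rc] c c'B)
    then have PL: "complex_of_real (1 / real a) * ?P $$ (u,v) = lin_combo c' L u v" if "u < a * b" "v < a * b" for u v
      using that by (simp add: Dm)
    have Yv: "Y $$ (u,v) = X $$ (u,v) - lin_combo c' L u v" if "u < a * b" "v < a * b" for u v
      using that Xc Pc by (simp add: Y_def PL[OF that, symmetric])
    have "hermitian_op (a * b) Y"
      unfolding Y_def using hermitian_kron_one[OF Rh, of "a * e"] X(1) by (intro hermitian_op_combo) (simp_all add: Dm)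
    moreover have "(\<Sum>i<a. Y $$ (i * b + u, i * b + v)) = 0" if uv: "u < b" "v < b" for u v
    proof -
      have "\<forall>u<e * m. \<forall>v<e * m. (\<Sum>i<a. X $$ (i * b + u, i * b + v) - lin_combo c' L (i * b + u) (i * b + v)) = 0"
        unfolding all_less_mult[of e m] sum_subtractf
      proof (intro allI impI)
        fix i' k j' l assume "i' < e" "k < m" "j' < e" "l < m"
        then show "(\<Sum>i<a. X $$ (i * b + (i' * m + k), i * b + (j' * m + l))) -
            (\<Sum>i<a. lin_combo c' L (i * b + (i' * m + k)) (i * b + (j' * m + l))) = 0"
          using pos(1) by (simp add: tr L_tr c'B c)
      qed
      moreover have "(\<Sum>i<a. Y $$ (i * b + u, i * b + v)) = (\<Sum>i<a. X $$ (i * b + u, i * b + v) - lin_combo c' L (i * b + u) (i * b + v))"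
        using uv by (intro sum.cong refl Yv) (auto intro: mult_add_less)
      ultimately show ?thesis using uv by (simp add: bem)
    qed
    ultimately have "in_rspan (a * b) K Y"
      unfolding K_def by (rule in_rspan_kron_products[OF E F])
    then obtain f where f: "\<And>u v. u < a * b \<Longrightarrow> v < a * b \<Longrightarrow> Y $$ (u,v) = lin_combo f K u v"
      unfolding in_rspan_lin_combo by blast
    have "X $$ (u,v) = lin_combo (join_coeffs (length L) c' f) (L @ K) u v" if "u < a * b" "v < a * b" for u v
      unfolding lin_combo_join_coeffs using Yv[OF that] f[OF that] by simp
    then show ?thesis unfolding in_rspan_lin_combo by (intro exI allI impI)
  qed
  ultimately show ?case unfolding D DN by blast
qed

section \<open>Extremality\<close>

text \<open>If B_k v = X w_k for every k, then the combination sends v to X applied to the same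
  combination of the w_k. Real coefficients preserve hermiticity.\<close>

lemma herm_supp_space_lin_combo:
  assumes X: "X \<in> carrier_mat n n" and B: "set Bs \<subseteq> herm_supp_space n X"
  shows "mat n n (\<lambda>(i,j). lin_combo c Bs i j) \<in> herm_supp_space n X" (is "?D \<in> _")
proof -
  have b: "hermitian_op n (Bs ! k)" "supp (Bs ! k) \<subseteq> supp X" if "k < length Bs" for k
    using subsetD[OF B nth_mem[OF that]] by (auto simp: herm_supp_space_def)
  have "hermitian_op n ?D"
    unfolding hermitian_op_def
  proof (intro conjI allI impI)
    fix i j assume ij: "i < n" "j < n"
    have "cnj (lin_combo c Bs i j) = lin_combo c Bs j i"
      unfolding lin_combo_def cnj_sum by (intro sum.cong refl) (simp add: hermitian_op_cnj[OF b(1) ij])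
    then show "?D $$ (j,i) = cnj (?D $$ (i,j))" using ij by simp
  qed simp
  moreover have "supp ?D \<subseteq> supp X"
  proof (subst supp_subset_iff[OF X], simp, intro allI)
    fix v
    have "\<forall>k. \<exists>w. k < length Bs \<longrightarrow> (\<forall>i<n. mat_app n (Bs ! k) v i = mat_app n X w i)"
    proof
      fix k
      show "\<exists>w. k < length Bs \<longrightarrow> (\<forall>i<n. mat_app n (Bs ! k) v i = mat_app n X w i)"
      proof (cases "k < length Bs")
        case True
        have "Bs ! k \<in> carrier_mat n n" using b(1)[OF True] by (simp add: hermitian_op_def)
        from supp_subset_iff[OF X this] b(2)[OF True] show ?thesis by simp
      qed simp
    qed
    from choice[OF this] obtain w where
      w: "\<forall>k. k < length Bs \<longrightarrow> (\<forall>i<n. mat_app n (Bs ! k) v i = mat_app n X (w k) i)" ..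
    show "\<exists>u. \<forall>i<n. mat_app n ?D v i = mat_app n X u i"
    proof (intro exI allI impI)
      fix i assume i: "i < n"
      have "mat_app n ?D v i = (\<Sum>j<n. \<Sum>k<length Bs. complex_of_real (c k) * ((Bs ! k) $$ (i,j) * v j))"
        using i by (simp add: mat_app_def lin_combo_def sum_distrib_right mult.assoc)
      also have "\<dots> = (\<Sum>k<length Bs. complex_of_real (c k) * mat_app n (Bs ! k) v i)"
        unfolding mat_app_def sum_distrib_left by (rule sum.swap)
      also have "\<dots> = (\<Sum>k<length Bs. complex_of_real (c k) * mat_app n X (w k) i)"
        using w i by simp
      also have "\<dots> = (\<Sum>j<n. \<Sum>k<length Bs. X $$ (i,j) * (complex_of_real (c k) * w k j))"
        unfolding mat_app_def sum_distrib_left by (subst sum.swap) (simp add: mult.left_commute)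
      also have "\<dots> = mat_app n X (\<lambda>j. \<Sum>k<length Bs. complex_of_real (c k) * w k j) i"
        by (simp add: mat_app_def sum_distrib_left)
      finally show "mat_app n ?D v i = mat_app n X (\<lambda>j. \<Sum>k<length Bs. complex_of_real (c k) * w k j) i" .
    qed
  qed
  ultimately show ?thesis by (simp add: herm_supp_space_def)
qed

section \<open>Sums over the outcomes of an instrument\<close>

lemma sum_ops_carrier: "sum_ops n M A \<in> carrier_mat n n"
  by (simp add: sum_ops_def)

lemma sum_ops_combo:
  assumes "\<And>m. m \<in> {1..M} \<Longrightarrow> A m \<in> carrier_mat n n" "\<And>m. m \<in> {1..M} \<Longrightarrow> B m \<in> carrier_mat n n"
  shows "sum_ops n M (\<lambda>m. x \<cdot>\<^sub>m A m + y \<cdot>\<^sub>m B m) = x \<cdot>\<^sub>m sum_ops n M A + y \<cdot>\<^sub>m sum_ops n M B"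
proof (rule eq_matI)
  fix i j assume "i < dim_row (x \<cdot>\<^sub>m sum_ops n M A + y \<cdot>\<^sub>m sum_ops n M B)"
    "j < dim_col (x \<cdot>\<^sub>m sum_ops n M A + y \<cdot>\<^sub>m sum_ops n M B)"
  then have ij: "i < n" "j < n" by (auto simp: sum_ops_def)
  have "(\<Sum>m\<in>{1..M}. (x \<cdot>\<^sub>m A m + y \<cdot>\<^sub>m B m) $$ (i,j)) = (\<Sum>m\<in>{1..M}. x * A m $$ (i,j) + y * B m $$ (i,j))"
  proof (rule sum.cong[OF refl])
    fix m assume "m \<in> {1..M}"
    from assms[OF this] show "(x \<cdot>\<^sub>m A m + y \<cdot>\<^sub>m B m) $$ (i,j) = x * A m $$ (i,j) + y * B m $$ (i,j)"
      using ij by simp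
  qed
  then show "sum_ops n M (\<lambda>m. x \<cdot>\<^sub>m A m + y \<cdot>\<^sub>m B m) $$ (i,j) = (x \<cdot>\<^sub>m sum_ops n M A + y \<cdot>\<^sub>m sum_ops n M B) $$ (i,j)"
    using ij by (simp add: sum_ops_def sum.distrib sum_distrib_left)
qed (simp_all add: sum_ops_def)

lemma qf_sum_ops: "qf n (sum_ops n M A) v = (\<Sum>m\<in>{1..M}. qf n (A m) v)"
proof -
  have "mat_app n (sum_ops n M A) v i = (\<Sum>m\<in>{1..M}. mat_app n (A m) v i)" if "i < n" for i
    using that unfolding mat_app_def by (subst sum.swap) (simp add: sum_ops_def sum_distrib_right)
  then have "qf n (sum_ops n M A) v = ip n v (\<lambda>i. \<Sum>m\<in>{1..M}. mat_app n (A m) v i)"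
    by (intro ip_cong) auto
  also have "\<dots> = (\<Sum>m\<in>{1..M}. qf n (A m) v)"
    unfolding ip_def sum_distrib_left by (rule sum.swap)
  finally show ?thesis .
qed

lemma positive_op_sum_ops:
  assumes "\<And>m. m \<in> {1..M} \<Longrightarrow> positive_op n (A m)"
  shows "positive_op n (sum_ops n M A)"
  using assms unfolding positive_op_iff qf_sum_ops
  by (auto simp: sum_ops_carrier intro!: sum_nonneg sum.neutral)

text \<open>The sum inherits positivity from its summands, so the instrument condition separates
  into positivity outcome by outcome and one affine condition on the sum.\<close>

lemma gen_instrument_iff_lin_comb:
  assumes "1 \<le> N"
  shows "gen_instrument d N M A \<longleftrightarrow>
    (\<forall>m\<in>{1..M}. positive_op (dimp d (2*N)) (A m)) \<and> lin_comb d N 1 (sum_ops (dimp d (2*N)) M A)"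
  unfolding gen_instrument_def det_comb_iff_lin_comb[OF assms] using positive_op_sum_ops by blast

lemma positive_op_carrier: "positive_op n X \<Longrightarrow> X \<in> carrier_mat n n"
  by (simp add: positive_op_def)

theorem theorem1:
  fixes d :: "nat \<Rightarrow> nat" and N M :: nat and T :: "nat \<Rightarrow> complex mat"
    and Hs Es Fs :: "nat \<Rightarrow> complex mat list"
  assumes "1 \<le> N" and "1 \<le> M" and "\<forall>k<2*N. 0 < d k"
    and "gen_instrument d N M T"
    and "\<forall>i\<in>{1..M}. is_rbasis (dimp d (2*N)) (herm_supp_space (dimp d (2*N)) (T i)) (Hs i)"
    and "\<forall>k<2*N. is_rbasis (d k) (traceless_herm_space (d k)) (Es k)"
    and "\<forall>k<2*N. even k \<longrightarrow> is_rbasis (dimp d (Suc k)) (herm_space (dimp d (Suc k))) (Fs k)"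
  shows "extremal_instrument d N M T \<longleftrightarrow>
           rlin_indep (dimp d (2*N)) (DM_family M Hs @ DN_family d N Es Fs)"
proof -
  define D where "D = dimp d (2*N)"
  define K where "K = DN_family d N Es Fs"
  have inst: "gen_instrument d N M A \<longleftrightarrow>
    (\<forall>m\<in>{1..M}. positive_op D (A m)) \<and> lin_comb d N 1 (sum_ops D M A)" for A
    unfolding D_def by (rule gen_instrument_iff_lin_comb[OF assms(1)])
  have H: "is_rbasis D (herm_supp_space D (T m)) (Hs m)" if "m \<in> {1..M}" for m
    using assms(5) that by (simp add: D_def)
  have T: "positive_op D (T m)" if "m \<in> {1..M}" for m using assms(4) that by (simp add: inst)
  have T1: "lin_comb d N 1 (sum_ops D M T)" using assms(4) by (simp add: inst)
  have DN: "rlin_indep D K \<and>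
    (\<forall>X \<in> carrier_mat D D. in_rspan D K X \<longrightarrow> lin_comb d N 0 X) \<and>
    (\<forall>X. hermitian_op D X \<longrightarrow> lin_comb d N 0 X \<longrightarrow> in_rspan D K X)"
    unfolding D_def K_def by (rule DN_family_indep_and_span) (use assms(3,6,7) in auto)
  \<comment> \<open>Independence now reads: operators X_m in the spans of the \<open>Hs m\<close>
    whose sum lies in the span of \<open>K\<close> all vanish. Via \<open>DN\<close> these are the
    admissible perturbation directions.\<close>
  have iff: "rlin_indep D (DM_family M Hs @ K) \<longleftrightarrow>
    (\<forall>c e. (\<forall>i<D. \<forall>j<D. (\<Sum>m\<in>{1..M}. lin_combo (c m) (Hs m) i j) + lin_combo e K i j = 0)
      \<longrightarrow> (\<forall>m\<in>{1..M}. \<forall>i<D. \<forall>j<D. lin_combo (c m) (Hs m) i j = 0))"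
    by (rule rlin_indep_DM_family_append) (use H DN in \<open>auto simp: is_rbasis_def\<close>)
  have "rlin_indep D (DM_family M Hs @ K)" if ext: "extremal_instrument d N M T"
    unfolding iff
  proof (rule allI, rule allI, rule impI)
    fix c e assume z: "\<forall>i<D. \<forall>j<D. (\<Sum>m\<in>{1..M}. lin_combo (c m) (Hs m) i j) + lin_combo e K i j = 0"
    define X where "X = (\<lambda>m. mat D D (\<lambda>(i,j). lin_combo (c m) (Hs m) i j))"
    have Xs: "X m \<in> herm_supp_space D (T m)" if "m \<in> {1..M}" for m
      unfolding X_def using H[OF that] positive_op_carrier[OF T[OF that]]
      by (intro herm_supp_space_lin_combo) (auto simp: is_rbasis_def)
    have Xc: "X m \<in> carrier_mat D D" for m by (simp add: X_def)
    have "in_rspan D K (sum_ops D M X)"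
      unfolding in_rspan_lin_combo
    proof (intro exI allI impI)
      fix i j assume ij: "i < D" "j < D"
      have "sum_ops D M X $$ (i,j) = (\<Sum>m\<in>{1..M}. lin_combo (c m) (Hs m) i j)"
        using ij by (simp add: sum_ops_def X_def)
      also have "\<dots> = - lin_combo e K i j" using z ij by (simp add: eq_neg_iff_add_eq_0)
      also have "\<dots> = lin_combo (\<lambda>k. -1 * e k + 0 * e k) K i j" by (subst lin_combo_combo) simp
      finally show "sum_ops D M X $$ (i,j) = lin_combo (\<lambda>k. -1 * e k + 0 * e k) K i j" .
    qed
    then have X0: "lin_comb d N 0 (sum_ops D M X)" using DN sum_ops_carrier by blast
    \<comment> \<open>A radius is chosen for every natural number, with 1 as default outside the
      outcomes.\<close>
    have "\<forall>m. \<exists>r>0. m \<in> {1..M} \<longrightarrow>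
        (\<forall>s. \<bar>s\<bar> \<le> r \<longrightarrow> positive_op D (1 \<cdot>\<^sub>m T m + complex_of_real s \<cdot>\<^sub>m X m))"
    proof
      fix m show "\<exists>r>0. m \<in> {1..M} \<longrightarrow>
        (\<forall>s. \<bar>s\<bar> \<le> r \<longrightarrow> positive_op D (1 \<cdot>\<^sub>m T m + complex_of_real s \<cdot>\<^sub>m X m))"
      proof (cases "m \<in> {1..M}")
        case True
        then show ?thesis using positive_op_perturb[OF T[OF True] Xs[OF True]] by blast
      next
        case False
        then show ?thesis by (intro exI[of _ 1]) (simp del: atLeastAtMost_iff)
      qed
    qed
    from choice[OF this] obtain r where r': "\<forall>m. r m > 0 \<and> (m \<in> {1..M} \<longrightarrow>
        (\<forall>s. \<bar>s\<bar> \<le> r m \<longrightarrow> positive_op D (1 \<cdot>\<^sub>m T m + complex_of_real s \<cdot>\<^sub>m X m)))" ..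
    have r: "r m > 0" "m \<in> {1..M} \<Longrightarrow> \<bar>s\<bar> \<le> r m \<Longrightarrow> positive_op D (1 \<cdot>\<^sub>m T m + complex_of_real s \<cdot>\<^sub>m X m)" for m s
      using r'[THEN spec[of _ m]] by simp_all
    \<comment> \<open>One radius for all outcomes; the minimum is over a nonempty set because
      \<open>M\<close> is at least 1.\<close>
    define q where "q = Min (r ` {1..M})"
    have q: "q > 0" "\<And>m. m \<in> {1..M} \<Longrightarrow> q \<le> r m"
      using r(1) assms(2) by (auto simp: q_def)
    have inst_s: "gen_instrument d N M (\<lambda>m. 1 \<cdot>\<^sub>m T m + complex_of_real s \<cdot>\<^sub>m X m)" if s: "\<bar>s\<bar> = q" for s
    proof -
      have "lin_comb d N (1 * 1 + s * 0) (complex_of_real 1 \<cdot>\<^sub>m sum_ops D M T + complex_of_real s \<cdot>\<^sub>m sum_ops D M X)"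
        by (rule lin_comb_combo[OF T1 X0])
      moreover have "sum_ops D M (\<lambda>m. 1 \<cdot>\<^sub>m T m + complex_of_real s \<cdot>\<^sub>m X m)
          = 1 \<cdot>\<^sub>m sum_ops D M T + complex_of_real s \<cdot>\<^sub>m sum_ops D M X"
        by (rule sum_ops_combo) (use Xc positive_op_carrier[OF T] in auto)
      moreover have "positive_op D (1 \<cdot>\<^sub>m T m + complex_of_real s \<cdot>\<^sub>m X m)" if "m \<in> {1..M}" for m
        using r(2)[OF that] q(2)[OF that] s by simp
      ultimately show ?thesis unfolding inst by simp
    qed
    \<comment> \<open>\<open>T\<close> is the midpoint of the instruments T + q X and T - q X, so
      extremality makes both equal to \<open>T\<close>.\<close>
    have mid: "T m = complex_of_real (1/2) \<cdot>\<^sub>m (1 \<cdot>\<^sub>m T m + complex_of_real q \<cdot>\<^sub>m X m)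
        + complex_of_real (1 - 1/2) \<cdot>\<^sub>m (1 \<cdot>\<^sub>m T m + complex_of_real (- q) \<cdot>\<^sub>m X m)" if "m \<in> {1..M}" for m
      using Xc[of m] positive_op_carrier[OF T[OF that]] by (intro eq_matI) (auto simp: field_simps)
    have fix_T: "1 \<cdot>\<^sub>m T m + complex_of_real q \<cdot>\<^sub>m X m = T m" if "m \<in> {1..M}" for m
    proof -
      have "\<forall>m\<in>{1..M}. 1 \<cdot>\<^sub>m T m + complex_of_real q \<cdot>\<^sub>m X m = T m \<and>
          1 \<cdot>\<^sub>m T m + complex_of_real (- q) \<cdot>\<^sub>m X m = T m"
      proof (rule ext[unfolded extremal_instrument_def, THEN conjunct2, THEN spec, THEN spec, THEN spec[of _ "1/2"], THEN mp],
          intro conjI ballI)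
        show "gen_instrument d N M (\<lambda>m. 1 \<cdot>\<^sub>m T m + complex_of_real q \<cdot>\<^sub>m X m)"
          "gen_instrument d N M (\<lambda>m. 1 \<cdot>\<^sub>m T m + complex_of_real (- q) \<cdot>\<^sub>m X m)"
          using q(1) by (intro inst_s; simp)+
      qed (use mid in simp_all)
      then show ?thesis using that by blast
    qed
    show "\<forall>m\<in>{1..M}. \<forall>i<D. \<forall>j<D. lin_combo (c m) (Hs m) i j = 0"
    proof (intro ballI allI impI)
      fix m i j assume m: "m \<in> {1..M}" and ij: "i < D" "j < D"
      have "(1 \<cdot>\<^sub>m T m + complex_of_real q \<cdot>\<^sub>m X m) $$ (i,j) = T m $$ (i,j)" using fix_T[OF m] by simp
      then have "complex_of_real q * lin_combo (c m) (Hs m) i j = 0"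
        using ij positive_op_carrier[OF T[OF m]] by (simp add: X_def)
      then show "lin_combo (c m) (Hs m) i j = 0" using q(1) by simp
    qed
  qed
  moreover have "extremal_instrument d N M T" if ind: "rlin_indep D (DM_family M Hs @ K)"
    unfolding extremal_instrument_def
  proof (intro conjI assms(4), rule allI, rule allI, rule allI, rule impI, elim conjE)
    fix A B and t :: real
    assume A: "gen_instrument d N M A" and B: "gen_instrument d N M B" and t: "0 < t" "t < 1"
      and TAB: "\<forall>m\<in>{1..M}. T m = complex_of_real t \<cdot>\<^sub>m A m + complex_of_real (1 - t) \<cdot>\<^sub>m B m"
    have pos: "positive_op D (A m)" "positive_op D (B m)" if "m \<in> {1..M}" for m
      using A B that by (simp_all add: inst)
    note carr = pos[THEN positive_op_carrier]
    \<comment> \<open>The difference of the two instruments: its support is controlled by the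
      mixture, and its sum has r = 1 - 1 = 0.\<close>
    define X where "X = (\<lambda>m. 1 \<cdot>\<^sub>m A m + (-1) \<cdot>\<^sub>m B m)"
    have Xs: "X m \<in> herm_supp_space D (T m)" if "m \<in> {1..M}" for m
      unfolding X_def TAB[rule_format, OF that] by (rule convex_diff_in_herm_supp_space[OF pos[OF that] t])
    have "\<forall>m. \<exists>c. m \<in> {1..M} \<longrightarrow> (\<forall>i<D. \<forall>j<D. X m $$ (i,j) = lin_combo c (Hs m) i j)"
    proof
      fix m show "\<exists>c. m \<in> {1..M} \<longrightarrow> (\<forall>i<D. \<forall>j<D. X m $$ (i,j) = lin_combo c (Hs m) i j)"
      proof (cases "m \<in> {1..M}")
        case True
        then have "in_rspan D (Hs m) (X m)" using H[OF True] Xs[OF True] by (simp add: is_rbasis_def)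
        then show ?thesis unfolding in_rspan_lin_combo by blast
      qed (simp del: atLeastAtMost_iff)
    qed
    from choice[OF this] obtain c where
      c': "\<forall>m. m \<in> {1..M} \<longrightarrow> (\<forall>i<D. \<forall>j<D. X m $$ (i,j) = lin_combo (c m) (Hs m) i j)" ..
    have c: "X m $$ (i,j) = lin_combo (c m) (Hs m) i j" if "m \<in> {1..M}" "i < D" "j < D" for m i j
      using c'[THEN spec, THEN mp, OF that(1)] that by simp
    have "lin_comb d N 0 (sum_ops D M X)"
    proof -
      have "lin_comb d N (1 * 1 + (-1) * 1) (complex_of_real 1 \<cdot>\<^sub>m sum_ops D M A + complex_of_real (-1) \<cdot>\<^sub>m sum_ops D M B)"
        using A B unfolding inst by (intro lin_comb_combo) auto
      moreover have "sum_ops D M X = 1 \<cdot>\<^sub>m sum_ops D M A + (-1) \<cdot>\<^sub>m sum_ops D M B"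
        unfolding X_def by (rule sum_ops_combo) (use carr in auto)
      ultimately show ?thesis by simp
    qed
    moreover have "hermitian_op D (sum_ops D M X)"
      unfolding hermitian_op_def
    proof (intro conjI allI impI sum_ops_carrier)
      fix i j assume ij: "i < D" "j < D"
      have "X m $$ (j,i) = cnj (X m $$ (i,j))" if "m \<in> {1..M}" for m
        using Xs[OF that] hermitian_op_cnj[of D "X m" i j] ij by (simp add: herm_supp_space_def)
      then show "sum_ops D M X $$ (j,i) = cnj (sum_ops D M X $$ (i,j))"
        using ij by (simp add: sum_ops_def)
    qed
    ultimately have "in_rspan D K (sum_ops D M X)" using DN by blast
    then obtain e where e: "\<And>i j. i < D \<Longrightarrow> j < D \<Longrightarrow> sum_ops D M X $$ (i,j) = lin_combo e K i j"
      unfolding in_rspan_lin_combo by blast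
    \<comment> \<open>The sum of the X_m is the combination \<open>e\<close> of \<open>K\<close>;
      negating \<open>e\<close> turns this into a relation in the joint family.\<close>
    have "(\<Sum>m\<in>{1..M}. lin_combo (c m) (Hs m) i j) + lin_combo (\<lambda>k. -1 * e k + 0 * e k) K i j = 0"
      if ij: "i < D" "j < D" for i j
    proof -
      have "(\<Sum>m\<in>{1..M}. lin_combo (c m) (Hs m) i j) = sum_ops D M X $$ (i,j)"
        using c ij by (simp add: sum_ops_def)
      then show ?thesis unfolding lin_combo_combo using e[OF ij] by simp
    qed
    then have z: "\<forall>m\<in>{1..M}. \<forall>i<D. \<forall>j<D. lin_combo (c m) (Hs m) i j = 0"
      by (intro ind[unfolded iff, THEN spec[of _ c], THEN spec[of _ "\<lambda>k. -1 * e k + 0 * e k"], THEN mp] allI impI)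
    show "\<forall>m\<in>{1..M}. A m = T m \<and> B m = T m"
    proof
      fix m assume m: "m \<in> {1..M}"
      have AB: "A m $$ (i,j) = B m $$ (i,j)" if "i < D" "j < D" for i j
      proof -
        have "X m $$ (i,j) = 0" using c[OF m that] z m that by simp
        then show ?thesis using carr[OF m] that by (simp add: X_def)
      qed
      have "A m = B m" using carr[OF m] AB by (intro eq_matI) auto
      \<comment> \<open>With A_m = B_m the weights t and 1 - t add up to 1.\<close>
      moreover have "T m = A m"
        unfolding TAB[rule_format, OF m] using carr[OF m] AB
        by (intro eq_matI) (auto simp: algebra_simps)
      ultimately show "A m = T m \<and> B m = T m" by simp
    qed
  qed
  ultimately show ?thesis unfolding D_def K_def by blast
qed

end
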